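(* Let $n_x,n_y,n_z$ be pairwise relatively prime positive integers. Then $\mathcal{L}(n_x,n_y,n_z)\subseteq \mathcal{L}(n_x,n_y,n_z+2n_xn_y)$, with equality if $n_z\ge 2n_xn_y-n_y$.
   Context: A Lissajous knot is a knot in $\mathbb{R}^3$ admitting a parameterization $K(t)=(\cos(n_xt+\phi_x),\cos(n_yt+\phi_y),\cos(n_zt+\phi_z))$, $0\le t\le 2\pi$, where the frequencies $n_x,n_y,n_z$ are integers and the phase shifts $\phi_x,\phi_y,\phi_z$ are real numbers (chosen so that the curve is embedded). $\mathcal{L}(n_x,n_y,n_z)$ denotes the set of knot types of all Lissajous knots with frequencies $n_x,n_y,n_z$, where a knot and its mirror image are considered equivalent. *)

theory Defs
  imports "HOL-Analysis.Analysis"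
begin

type_synonym R3 = "real \<times> real \<times> real"

definition lissajous_curve :: "int \<Rightarrow> int \<Rightarrow> int \<Rightarrow> real \<Rightarrow> real \<Rightarrow> real \<Rightarrow> real \<Rightarrow> R3" where
  "lissajous_curve nx ny nz px py pz t =
     (cos (of_int nx * t + px), cos (of_int ny * t + py), cos (of_int nz * t + pz))"

definition lissajous_knots :: "int \<Rightarrow> int \<Rightarrow> int \<Rightarrow> R3 set set" where
  "lissajous_knots nx ny nz =
     {lissajous_curve nx ny nz px py pz ` {0..2*pi} | px py pz.
        inj_on (lissajous_curve nx ny nz px py pz) {0..<2*pi}}"

definition ambient_isotopic :: "R3 set \<Rightarrow> R3 set \<Rightarrow> bool" where
  "ambient_isotopic A B \<longleftrightarrow>
     (\<exists>H :: real \<Rightarrow> R3 \<Rightarrow> R3.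
        continuous_on ({0..1} \<times> UNIV) (\<lambda>(t, x). H t x) \<and>
        (\<forall>t\<in>{0..1}. \<exists>G. homeomorphism UNIV UNIV (H t) G) \<and>
        (\<forall>x. H 0 x = x) \<and>
        H 1 ` A = B)"

definition mirror :: "R3 \<Rightarrow> R3" where
  "mirror = (\<lambda>(x, y, z). (x, y, - z))"

definition knot_equiv :: "R3 set \<Rightarrow> R3 set \<Rightarrow> bool" where
  "knot_equiv A B \<longleftrightarrow> ambient_isotopic A B \<or> ambient_isotopic A (mirror ` B)"

definition lissajous_types :: "int \<Rightarrow> int \<Rightarrow> int \<Rightarrow> R3 set set set" where
  "lissajous_types nx ny nz = {{B. knot_equiv K B} | K. K \<in> lissajous_knots nx ny nz}"

end

theory Submission
  imports Defs
begin

text \<open>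
  Put \<open>\<delta> = (n\<^sub>y \<phi>\<^sub>x - n\<^sub>x \<phi>\<^sub>y) / \<pi>\<close>, \<open>A = (n\<^sub>y \<phi>\<^sub>z - n\<^sub>z \<phi>\<^sub>y) / \<pi>\<close> and \<open>B = (n\<^sub>x \<phi>\<^sub>z - n\<^sub>z \<phi>\<^sub>x) / \<pi>\<close>, so that
  \<open>n\<^sub>x A - n\<^sub>y B = n\<^sub>z \<delta>\<close>. As long as \<open>\<delta>\<close> stays in an open unit interval \<open>(m, m + 1)\<close>, the projections to
  the \<open>xy\<close>-plane differ only by a planar isotopy. There are two families of crossings, and their signs
  depend only on the unit intervals containing \<open>A\<close> modulo \<open>2 n\<^sub>y\<close> and \<open>B\<close> modulo \<open>2 n\<^sub>x\<close> and on \<open>n\<^sub>z\<close> modulo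
  \<open>2 n\<^sub>x n\<^sub>y\<close>. Hence replacing \<open>n\<^sub>z\<close> by \<open>n\<^sub>z + 2 n\<^sub>x n\<^sub>y\<close> merely enlarges the range of \<open>n\<^sub>z \<delta>\<close>, i.e. the set of
  pairs of unit intervals that occur, and for \<open>n\<^sub>z \<ge> 2 n\<^sub>x n\<^sub>y - n\<^sub>y\<close> all pairs occur already.

  Two curves with the same planar projection and the same crossing signs are isotopic along the
  vertical lines. The remaining case \<open>\<delta> \<in> \<int>\<close> forces \<open>n\<^sub>z = 1\<close>, and there an isotopy along a
  horizontal coordinate direction makes \<open>\<delta>\<close> non-integral.
\<close>

subsection \<open>Ambient isotopy as an equivalence relation\<close>

text \<open>By invariance of domain a continuous bijection of Euclidean space is a homeomorphism, so
  the stages only have to be continuous and bijective.\<close>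

lemma ambient_isotopicI:
  fixes H :: "real \<Rightarrow> R3 \<Rightarrow> R3"
  assumes "continuous_on ({0..1} \<times> UNIV) (\<lambda>(t, x). H t x)"
    and "\<And>t. t \<in> {0..1} \<Longrightarrow> bij (H t)"
    and "\<And>x. H 0 x = x" and "H 1 ` A = B"
  shows "ambient_isotopic A B"
  unfolding ambient_isotopic_def
proof (intro exI[of _ H] conjI ballI allI)
  fix t :: real assume t: "t \<in> {0..1}"
  have "continuous_on UNIV ((\<lambda>(t, x). H t x) \<circ> (\<lambda>x. (t, x)))"
    by (intro continuous_on_compose continuous_intros continuous_on_subset[OF assms(1)])
       (use t in auto)
  then have "continuous_on UNIV (H t)" by (simp add: comp_def)
  moreover have "inj (H t)" and "range (H t) = UNIV"
    using assms(2)[OF t] by (auto simp: bij_def)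
  ultimately show "\<exists>G. homeomorphism UNIV UNIV (H t) G"
    by (metis invariance_of_domain_homeomorphism open_UNIV order_refl)
qed (use assms in auto)

lemma ambient_isotopicD:
  assumes "ambient_isotopic A B"
  shows "\<exists>H :: real \<Rightarrow> R3 \<Rightarrow> R3. continuous_on ({0..1} \<times> UNIV) (\<lambda>(t, x). H t x) \<and>
     (\<forall>t\<in>{0..1}. bij (H t)) \<and> (\<forall>x. H 0 x = x) \<and> H 1 ` A = B"
proof -
  obtain H :: "real \<Rightarrow> R3 \<Rightarrow> R3"
    where H: "continuous_on ({0..1} \<times> UNIV) (\<lambda>(t, x). H t x)"
      "\<forall>t\<in>{0..1}. \<exists>G. homeomorphism UNIV UNIV (H t) G" "\<forall>x. H 0 x = x" "H 1 ` A = B"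
    using assms unfolding ambient_isotopic_def by blast
  have "bij (H t)" if "t \<in> {0..1}" for t
    using H(2) that unfolding homeomorphism_def bij_def
    by (metis UNIV_I inj_on_inverseI)
  with H show ?thesis by blast
qed

lemma continuous_on_isotopy_compose:
  fixes H :: "real \<Rightarrow> R3 \<Rightarrow> R3"
  assumes "continuous_on ({0..1} \<times> UNIV) (\<lambda>(t, x). H t x)"
    and "continuous_on S f" "continuous_on S g" "f ` S \<subseteq> {0..1}"
  shows "continuous_on S (\<lambda>p. H (f p) (g p))"
proof -
  have "continuous_on S ((\<lambda>(t, x). H t x) \<circ> (\<lambda>p. (f p, g p)))"
    by (intro continuous_on_compose continuous_intros assms continuous_on_subset[OF assms(1)])
       (use assms(4) in auto)
  then show ?thesis by (simp add: comp_def)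
qed

lemma ambient_isotopic_refl: "ambient_isotopic A A"
  by (rule ambient_isotopicI[of "\<lambda>t x. x"]) (auto simp: case_prod_unfold bij_def intro!: continuous_intros)

lemma ambient_isotopic_trans:
  assumes "ambient_isotopic A B" "ambient_isotopic B C"
  shows "ambient_isotopic A C"
proof -
  obtain H :: "real \<Rightarrow> R3 \<Rightarrow> R3" where H: "continuous_on ({0..1} \<times> UNIV) (\<lambda>(t, x). H t x)"
     "\<forall>t\<in>{0..1}. bij (H t)" "\<forall>x. H 0 x = x" "H 1 ` A = B"
    using ambient_isotopicD[OF assms(1)] by blast
  obtain G :: "real \<Rightarrow> R3 \<Rightarrow> R3" where G: "continuous_on ({0..1} \<times> UNIV) (\<lambda>(t, x). G t x)"
     "\<forall>t\<in>{0..1}. bij (G t)" "\<forall>x. G 0 x = x" "G 1 ` B = C"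
    using ambient_isotopicD[OF assms(2)] by blast
  show ?thesis
  \<comment> \<open>Both isotopies run simultaneously rather than one after the other, which avoids
    gluing in time.\<close>
  proof (rule ambient_isotopicI[of "\<lambda>t. G t \<circ> H t"])
    show "continuous_on ({0..1} \<times> UNIV) (\<lambda>(t, x). (G t \<circ> H t) x)"
      unfolding case_prod_unfold comp_def
      by (intro continuous_on_isotopy_compose[OF G(1)] continuous_on_isotopy_compose[OF H(1)]
          continuous_intros) auto
    show "bij (G t \<circ> H t)" if "t \<in> {0..1}" for t
      using that H(2) G(2) by (intro bij_comp) auto
    show "(G 0 \<circ> H 0) x = x" for x
      by (simp add: G(3)[rule_format] H(3)[rule_format])
    show "(G 1 \<circ> H 1) ` A = C" unfolding image_comp[symmetric] H(4) G(4) ..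
  qed
qed

lemma ambient_isotopic_sym:
  assumes "ambient_isotopic A B"
  shows "ambient_isotopic B A"
proof -
  obtain H :: "real \<Rightarrow> R3 \<Rightarrow> R3" where H: "continuous_on ({0..1} \<times> UNIV) (\<lambda>(t, x). H t x)"
     "\<forall>t\<in>{0..1}. \<exists>G. homeomorphism UNIV UNIV (H t) G" "\<forall>x. H 0 x = x" "H 1 ` A = B"
    using assms unfolding ambient_isotopic_def by blast
  from H(2) obtain G where "homeomorphism UNIV UNIV (H 1) G" by force
  then have G: "continuous_on UNIV G" "\<And>p. G (H 1 p) = p" "\<And>p. H 1 (G p) = p"
    unfolding homeomorphism_def by auto
  have bij: "bij (H t)" if "t \<in> {0..1}" for t
    using H(2) that unfolding homeomorphism_def bij_def
    by (metis UNIV_I inj_on_inverseI)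
  have bG: "bij G"
    using G(2,3) by (auto intro!: o_bij[of "H 1" G])
  show ?thesis
  \<comment> \<open>Running time backwards after \<open>G\<close>, the inverse of the final stage,
    involves only this one inverse.\<close>
  proof (rule ambient_isotopicI[of "\<lambda>t. H (1 - t) \<circ> G"])
    have "continuous_on ({0..1} \<times> UNIV) (\<lambda>p::real \<times> R3. G (snd p))"
      by (rule continuous_on_compose2[OF G(1)]) (auto intro: continuous_intros)
    then show "continuous_on ({0..1} \<times> UNIV) (\<lambda>(t, x). (H (1 - t) \<circ> G) x)"
      unfolding case_prod_unfold comp_def
      by (intro continuous_on_isotopy_compose[OF H(1)] continuous_intros) auto
    show "(H (1 - 0) \<circ> G) x = x" for x using G(3) by simp
    show "(H (1 - 1) \<circ> G) ` B = A"
      unfolding H(4)[symmetric] image_image by (simp add: G(2) H(3)[rule_format])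
    show "bij (H (1 - t) \<circ> G)" if "t \<in> {0..1}" for t
      using that by (intro bij_comp bG bij) auto
  qed
qed

lemma ambient_isotopic_image:
  assumes "ambient_isotopic A B" and h: "homeomorphism UNIV UNIV h k"
  shows "ambient_isotopic (h ` A) (h ` B)"
proof -
  obtain H :: "real \<Rightarrow> R3 \<Rightarrow> R3" where H: "continuous_on ({0..1} \<times> UNIV) (\<lambda>(t, x). H t x)"
     "\<forall>t\<in>{0..1}. bij (H t)" "\<forall>x. H 0 x = x" "H 1 ` A = B"
    using ambient_isotopicD[OF assms(1)] by blast
  have hk: "continuous_on UNIV h" "continuous_on UNIV k" "\<And>x. k (h x) = x" "\<And>x. h (k x) = x"
    using h unfolding homeomorphism_def by auto
  have b: "bij h" "bij k"
    using hk by (auto intro!: o_bij[of k h] o_bij[of h k])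
  show ?thesis
  proof (rule ambient_isotopicI[of "\<lambda>t. h \<circ> (H t \<circ> k)"])
    have "continuous_on ({0..1} \<times> UNIV) (\<lambda>p::real \<times> R3. k (snd p))"
      by (rule continuous_on_compose2[OF hk(2)]) (auto intro: continuous_intros)
    then have "continuous_on ({0..1} \<times> UNIV) (\<lambda>p::real \<times> R3. H (fst p) (k (snd p)))"
      by (intro continuous_on_isotopy_compose[OF H(1)] continuous_intros) auto
    then show "continuous_on ({0..1} \<times> UNIV) (\<lambda>(t, x). (h \<circ> (H t \<circ> k)) x)"
      unfolding case_prod_unfold comp_def
      by (rule continuous_on_compose2[OF hk(1)]) auto
    show "(h \<circ> (H 1 \<circ> k)) ` h ` A = h ` B"
      unfolding H(4)[symmetric] image_image by (simp add: hk(3))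
    show "bij (h \<circ> (H t \<circ> k))" if "t \<in> {0..1}" for t
      using that H(2) b by (intro bij_comp) auto
    show "(h \<circ> (H 0 \<circ> k)) x = x" for x
      by (simp add: hk(4) H(3)[rule_format])
  qed
qed

lemma homeomorphism_involution:
  fixes h :: "'a::topological_space \<Rightarrow> 'a"
  assumes "continuous_on UNIV h" "\<And>p. h (h p) = p"
  shows "homeomorphism UNIV UNIV h h"
proof -
  have "range h = UNIV" using assms(2) by (rule surjI)
  then show ?thesis using assms by (simp add: homeomorphism_def)
qed

lemma homeomorphism_mirror: "homeomorphism UNIV UNIV mirror mirror"
  by (rule homeomorphism_involution) (auto simp: mirror_def case_prod_unfold intro!: continuous_intros)

lemma mirror_mirror: "mirror ` mirror ` A = A"
proof -
  have "mirror \<circ> mirror = id" by (auto simp: mirror_def)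
  then show ?thesis by (simp add: image_comp)
qed

lemma ambient_isotopic_mirror: "ambient_isotopic A B \<Longrightarrow> ambient_isotopic (mirror ` A) (mirror ` B)"
  by (rule ambient_isotopic_image[OF _ homeomorphism_mirror])

lemma knot_equiv_sym:
  assumes "knot_equiv A B"
  shows "knot_equiv B A"
  using assms unfolding knot_equiv_def
proof
  assume "ambient_isotopic A (mirror ` B)"
  from ambient_isotopic_mirror[OF ambient_isotopic_sym[OF this]]
  show "ambient_isotopic B A \<or> ambient_isotopic B (mirror ` A)" by (simp add: mirror_mirror)
qed (blast intro: ambient_isotopic_sym)

lemma knot_equiv_trans:
  assumes "knot_equiv A B" "knot_equiv B C"
  shows "knot_equiv A C"
proof -
  have "ambient_isotopic (mirror ` B) C \<or> ambient_isotopic (mirror ` B) (mirror ` C)"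
    using assms(2) ambient_isotopic_mirror[of B C] ambient_isotopic_mirror[of B "mirror ` C"]
    unfolding knot_equiv_def by (auto simp only: mirror_mirror)
  then show ?thesis
    using assms unfolding knot_equiv_def by (blast intro: ambient_isotopic_trans)
qed

text \<open>Reduces equality of knot types to an ambient isotopy between representatives; mirror
  images are dealt with here once and for all.\<close>

lemma knot_class_eq:
  assumes "ambient_isotopic A B"
  shows "{C. knot_equiv A C} = {C. knot_equiv B C}"
proof -
  have AB: "knot_equiv A B" using assms by (simp add: knot_equiv_def)
  have "knot_equiv A C \<longleftrightarrow> knot_equiv B C" for C
    using knot_equiv_trans[OF AB, of C] knot_equiv_trans[OF knot_equiv_sym[OF AB], of C] by blast
  then show ?thesis by simp
qed

subsection \<open>Isotopies along one coordinate\<close>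

text \<open>Uniform continuity on a compact neighbourhood bounds the variation of \<phi> in y
  uniformly in t, and such a bound passes to the infimum.\<close>

lemma continuous_on_INF_compact:
  fixes \<phi> :: "'a::metric_space \<Rightarrow> 'b::heine_borel \<Rightarrow> real"
  assumes T: "compact T" "T \<noteq> {}" and S: "closed S"
    and cont: "continuous_on (T \<times> S) (\<lambda>(t, y). \<phi> t y)"
  shows "continuous_on S (\<lambda>y. INF t\<in>T. \<phi> t y)"
  unfolding continuous_on_iff
proof (intro ballI allI impI)
  fix y0 and e :: real assume y0: "y0 \<in> S" and e: "0 < e"
  let ?B = "cball y0 1 \<inter> S"
  have "compact (T \<times> ?B)"
    using T S by (intro compact_Times compact_Int_closed) auto
  moreover have "continuous_on (T \<times> ?B) (\<lambda>(t, y). \<phi> t y)"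
    by (rule continuous_on_subset[OF cont]) auto
  ultimately have "uniformly_continuous_on (T \<times> ?B) (\<lambda>(t, y). \<phi> t y)"
    using compact_uniformly_continuous by blast
  then obtain d where d: "d > 0"
    and D: "\<And>p q. p \<in> T \<times> ?B \<Longrightarrow> q \<in> T \<times> ?B \<Longrightarrow> dist q p < d \<Longrightarrow>
       dist ((\<lambda>(t, y). \<phi> t y) q) ((\<lambda>(t, y). \<phi> t y) p) < e/2"
    unfolding uniformly_continuous_on_def by (metis e half_gt_zero)
  have bdd: "bdd_below ((\<lambda>t. \<phi> t y) ` T)" if "y \<in> S" for y
  proof -
    have "continuous_on T ((\<lambda>(t, y). \<phi> t y) \<circ> (\<lambda>t. (t, y)))"
      by (intro continuous_on_compose continuous_intros continuous_on_subset[OF cont])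
         (use that in auto)
    then have "compact ((\<lambda>t. \<phi> t y) ` T)"
      using T by (intro compact_continuous_image) (auto simp: comp_def)
    then show ?thesis by (simp add: bounded_imp_bdd_below compact_imp_bounded)
  qed
  have le: "(INF t\<in>T. \<phi> t y) \<le> (INF t\<in>T. \<phi> t y') + e/2"
    if "y \<in> S" "\<And>t. t \<in> T \<Longrightarrow> \<phi> t y \<le> \<phi> t y' + e/2" for y y'
  proof -
    have "(INF t\<in>T. \<phi> t y) - e/2 \<le> (INF t\<in>T. \<phi> t y')"
    proof (rule cINF_greatest[OF T(2)])
      fix t assume t: "t \<in> T"
      have "(INF t\<in>T. \<phi> t y) \<le> \<phi> t y" by (rule cINF_lower[OF bdd[OF that(1)] t])
      with that(2)[OF t] show "(INF t\<in>T. \<phi> t y) - e/2 \<le> \<phi> t y'" by linarith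
    qed
    then show ?thesis by linarith
  qed
  show "\<exists>d>0. \<forall>y\<in>S. dist y y0 < d \<longrightarrow> dist (INF t\<in>T. \<phi> t y) (INF t\<in>T. \<phi> t y0) < e"
  proof (intro exI[of _ "min d 1"] conjI ballI impI)
    fix y assume y: "y \<in> S" "dist y y0 < min d 1"
    have *: "\<bar>\<phi> t y - \<phi> t y0\<bar> < e/2" if "t \<in> T" for t
      using D[of "(t, y0)" "(t, y)"] that y y0
      by (auto simp: dist_Pair_Pair dist_real_def dist_commute)
    have "(INF t\<in>T. \<phi> t y) \<le> (INF t\<in>T. \<phi> t y0) + e/2"
      using *[unfolded abs_less_iff] y(1) by (intro le) force+
    moreover have "(INF t\<in>T. \<phi> t y0) \<le> (INF t\<in>T. \<phi> t y) + e/2"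
      using *[unfolded abs_less_iff] y0 by (intro le) force+
    ultimately show "dist (INF t\<in>T. \<phi> t y) (INF t\<in>T. \<phi> t y0) < e"
      using e by (auto simp: dist_real_def)
  qed (use d in auto)
qed

text \<open>Take C r = sup over x of 2 max(0, \<psi> x) r / (r + d x). At r = d x > 0 the fraction
  is 1/2, so C (d x) dominates \<psi> x.\<close>

lemma modulus_exists:
  fixes \<psi> d :: "'a::metric_space \<Rightarrow> real"
  assumes X: "compact X" and \<psi>: "continuous_on X \<psi>" and d: "continuous_on X d"
    and d0: "\<And>x. x \<in> X \<Longrightarrow> d x \<ge> 0" and z: "\<And>x. x \<in> X \<Longrightarrow> d x = 0 \<Longrightarrow> \<psi> x \<le> 0"
  obtains C :: "real \<Rightarrow> real" where "continuous_on {0..} C" "C 0 = 0"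
    "\<And>x. x \<in> X \<Longrightarrow> \<psi> x \<le> C (d x)"
proof (cases "X = {}")
  case True
  then show ?thesis using that[of "\<lambda>_. 0"] by auto
next
  case False
  define \<xi> where "\<xi> x r = - (2 * max 0 (\<psi> x) * (r / (r + d x)))" for x and r :: real
  define C where "C r = - (INF x\<in>X. \<xi> x r)" for r
  have cont: "continuous_on (X \<times> {0..}) (\<lambda>(x, r). \<xi> x r)"
    unfolding continuous_on_def
  proof safe
    fix x0 :: 'a and r0 :: real assume x0: "x0 \<in> X" and r0: "r0 \<ge> 0"
    let ?F = "at (x0, r0) within X \<times> {0..}"
    have t\<psi>: "((\<lambda>p. \<psi> (fst p)) \<longlongrightarrow> \<psi> x0) ?F" and td: "((\<lambda>p. d (fst p)) \<longlongrightarrow> d x0) ?F"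
    proof -
      have "continuous_on (X \<times> {0..}) (\<lambda>p. \<psi> (fst p))" "continuous_on (X \<times> {0..}) (\<lambda>p. d (fst p))"
        by (intro continuous_on_compose2[OF \<psi>] continuous_on_compose2[OF d] continuous_intros; auto)+
      then show "((\<lambda>p. \<psi> (fst p)) \<longlongrightarrow> \<psi> x0) ?F" "((\<lambda>p. d (fst p)) \<longlongrightarrow> d x0) ?F"
        using x0 r0 unfolding continuous_on_def by force+
    qed
    show "((\<lambda>(x, r). \<xi> x r) \<longlongrightarrow> \<xi> x0 r0) ?F"
    proof (cases "r0 + d x0 = 0")
      case False
      have "((\<lambda>p. \<xi> (fst p) (snd p)) \<longlongrightarrow> \<xi> x0 r0) ?F"
        unfolding \<xi>_def using False
        by (intro tendsto_intros t\<psi> td) (auto intro!: tendsto_eq_intros)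
      then show ?thesis by (simp add: case_prod_unfold)
    next
      \<comment> \<open>Near r = d x = 0 the fraction has no limit in general but is bounded by 1,
        while its factor max(0, \<psi> x) tends to 0.\<close>
      case True
      then have dz: "d x0 = 0" "r0 = 0" using d0[OF x0] r0 by auto
      then have "max 0 (\<psi> x0) = 0" using z[OF x0] by simp
      then have lim: "((\<lambda>p. 2 * max 0 (\<psi> (fst p))) \<longlongrightarrow> 0) ?F"
        by (auto intro!: tendsto_eq_intros t\<psi>)
      have "((\<lambda>p. \<xi> (fst p) (snd p)) \<longlongrightarrow> 0) ?F"
      proof (rule Lim_null_comparison[OF _ lim])
        show "\<forall>\<^sub>F p in ?F. norm (\<xi> (fst p) (snd p)) \<le> 2 * max 0 (\<psi> (fst p))"
          unfolding eventually_at_filter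
        proof (intro always_eventually allI impI)
          fix p assume "p \<in> X \<times> {0::real..}"
          then have p: "fst p \<in> X" "snd p \<ge> 0" by auto
          then have "0 \<le> snd p / (snd p + d (fst p))" "snd p / (snd p + d (fst p)) \<le> 1"
            using d0[OF p(1)] by (auto simp: divide_simps)
          then have "\<bar>snd p / (snd p + d (fst p))\<bar> \<le> 1" by linarith
          from mult_left_mono[OF this, of "2 * max 0 (\<psi> (fst p))"]
          show "norm (\<xi> (fst p) (snd p)) \<le> 2 * max 0 (\<psi> (fst p))"
            by (simp add: \<xi>_def abs_mult)
        qed
      qed
      then show ?thesis using dz by (simp add: case_prod_unfold \<xi>_def)
    qed
  qed
  show ?thesis
  proof (rule that[of C])
    show "continuous_on {0..} C"
      unfolding C_def by (intro continuous_intros continuous_on_INF_compact X False cont)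
    show "C 0 = 0" using False by (simp add: C_def \<xi>_def)
    fix x assume x: "x \<in> X"
    have "continuous_on X ((\<lambda>(t, y). \<xi> t y) \<circ> (\<lambda>t. (t, d x)))"
      by (intro continuous_on_compose continuous_intros continuous_on_subset[OF cont])
         (use d0[OF x] in auto)
    then have "compact ((\<lambda>t. \<xi> t (d x)) ` X)"
      using X by (intro compact_continuous_image) (auto simp: comp_def)
    then have "(INF t\<in>X. \<xi> t (d x)) \<le> \<xi> x (d x)"
      by (intro cINF_lower x) (simp add: bounded_imp_bdd_below compact_imp_bounded)
    moreover have "\<xi> x (d x) \<le> - \<psi> x"
      using z[OF x] d0[OF x] by (cases "d x = 0") (auto simp: \<xi>_def)
    ultimately show "\<psi> x \<le> C (d x)" unfolding C_def by linarith
  qed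
qed

lemma bij_if_expanding:
  fixes k :: "real \<Rightarrow> real"
  assumes cont: "continuous_on UNIV k" and e: "e > 0"
    and inc: "\<And>w w'. w \<le> w' \<Longrightarrow> k w' - k w \<ge> e * (w' - w)"
  shows "bij k"
proof (rule bijI)
  show "inj k"
  proof (rule injI)
    fix x y assume "k x = k y"
    then show "x = y"
      using inc[of x y] inc[of y x] e
      by (cases x y rule: linorder_cases) (auto simp: mult_le_0_iff)
  qed
  have "\<exists>x. k x = y" for y
  proof -
    \<comment> \<open>A slope of at least \<open>e\<close> carries the value from \<open>k 0\<close>
      to \<open>y\<close> or beyond within distance \<open>r\<close>.\<close>
    define r where "r = \<bar>y - k 0\<bar> / e"
    have r: "r \<ge> 0" "e * r = \<bar>y - k 0\<bar>" using e by (auto simp: r_def)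
    have "k (- r) \<le> y" "y \<le> k r"
      using inc[of "- r" 0] inc[of 0 r] r by (auto simp: abs_if split: if_splits)
    then show ?thesis
      using IVT'[of k "-r" y r] r continuous_on_subset[OF cont] by auto
  qed
  then show "surj k" unfolding surj_def by metis
qed

text \<open>
  An asymmetric McShane extension: the height function \<open>z'\<close> is extended from the curve to all of
  space so that on every vertical line it is increasing with slopes between \<open>\<epsilon>\<close> and \<open>L\<close>.
\<close>

lemma ambient_isotopic_vertical:
  fixes x y z z' :: "real \<Rightarrow> real"
  assumes T: "compact T" "T \<noteq> {}"
    and cont: "continuous_on T x" "continuous_on T y" "continuous_on T z" "continuous_on T z'"
    and \<epsilon>: "0 < \<epsilon>" "\<epsilon> \<le> L"
    and bound: "\<And>t u. \<lbrakk>t \<in> T; u \<in> T; x t = x u; y t = y u; z u \<le> z t\<rbrakk> \<Longrightarrow>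
      \<epsilon> * (z t - z u) \<le> z' t - z' u \<and> z' t - z' u \<le> L * (z t - z u)"
  shows "ambient_isotopic ((\<lambda>t. (x t, y t, z t)) ` T) ((\<lambda>t. (x t, y t, z' t)) ` T)"
proof -
  \<comment> \<open>Slope L on the positive side and \<epsilon> on the negative one: for two curve
    points on a vertical line, \<open>g (z t - z u)\<close> bounds \<open>z' t - z' u\<close> from
    above whichever is higher.\<close>
  define g where "g v = max (L * v) (\<epsilon> * v)" for v :: real
  have g_mono: "\<epsilon> * (w' - w) \<le> g (w' - v) - g (w - v)" if "w \<le> w'" for w w' v
  proof -
    have "\<epsilon> * (w' - w) \<le> L * (w' - w)" using that \<epsilon> by (intro mult_right_mono) auto
    then show ?thesis unfolding g_def by (simp add: algebra_simps max_def)
  qed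
  define d where "d p = dist (x (fst p), y (fst p)) (x (snd p), y (snd p))" for p
  define \<psi> where "\<psi> p = z' (fst p) - z' (snd p) - g (z (fst p) - z (snd p))" for p
  have comp: "continuous_on (T \<times> T) (\<lambda>p. h (fst p))" "continuous_on (T \<times> T) (\<lambda>p. h (snd p))"
    if "continuous_on T h" for h :: "real \<Rightarrow> real"
    by (rule continuous_on_compose2[OF that]; force intro: continuous_intros)+
  obtain C where C: "continuous_on {0..} C" "C 0 = 0" "\<And>p. p \<in> T \<times> T \<Longrightarrow> \<psi> p \<le> C (d p)"
  proof (rule modulus_exists)
    show "compact (T \<times> T)" using T by (simp add: compact_Times)
    show "continuous_on (T \<times> T) \<psi>"
      unfolding \<psi>_def g_def by (intro continuous_intros comp cont)
    show "continuous_on (T \<times> T) d"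
      unfolding d_def by (intro continuous_intros comp cont)
    show "d p \<ge> 0" for p by (simp add: d_def)
    fix p assume p: "p \<in> T \<times> T" "d p = 0"
    show "\<psi> p \<le> 0"
      using bound[of "fst p" "snd p"] bound[of "snd p" "fst p"] p
      unfolding \<psi>_def d_def g_def by (cases "z (snd p) \<le> z (fst p)") (auto simp: algebra_simps)
  qed blast
  \<comment> \<open>Each curve point \<open>u\<close> imposes an upper barrier with value
    \<open>z' u\<close> at itself. The term in \<open>C\<close> raises it over other vertical lines
    enough to stay above \<open>z'\<close> along the whole curve.\<close>
  define \<phi> where "\<phi> u q = z' u + g (snd (snd q) - z u) + C (dist (fst q, fst (snd q)) (x u, y u))"
    for u and q :: R3
  have comp1: "continuous_on (T \<times> UNIV) (\<lambda>p::real \<times> R3. h (fst p))"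
    if "continuous_on T h" for h :: "real \<Rightarrow> real"
    by (rule continuous_on_compose2[OF that]; force intro: continuous_intros)
  have cont_\<phi>: "continuous_on (T \<times> UNIV) (\<lambda>(u, q). \<phi> u q)"
    unfolding \<phi>_def g_def case_prod_unfold
    by (intro continuous_intros comp1 cont continuous_on_compose2[OF C(1)]) auto
  define F where "F q = (INF u\<in>T. \<phi> u q)" for q
  have cont_F: "continuous_on UNIV F"
    unfolding F_def by (intro continuous_on_INF_compact T cont_\<phi>) auto
  have bdd: "bdd_below ((\<lambda>u. \<phi> u q) ` T)" for q
  proof -
    have "continuous_on T ((\<lambda>(u, q). \<phi> u q) \<circ> (\<lambda>u. (u, q)))"
      by (intro continuous_on_compose continuous_intros continuous_on_subset[OF cont_\<phi>]) auto
    then have "compact ((\<lambda>u. \<phi> u q) ` T)"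
      using T by (intro compact_continuous_image) (auto simp: comp_def)
    then show ?thesis by (simp add: bounded_imp_bdd_below compact_imp_bounded)
  qed
  have F_curve: "F (x t, y t, z t) = z' t" if t: "t \<in> T" for t
  proof (rule antisym)
    have "F (x t, y t, z t) \<le> \<phi> t (x t, y t, z t)"
      unfolding F_def by (rule cINF_lower[OF bdd t])
    also have "\<dots> = z' t" using C(2) by (simp add: \<phi>_def g_def)
    finally show "F (x t, y t, z t) \<le> z' t" .
    show "z' t \<le> F (x t, y t, z t)"
      unfolding F_def
    proof (rule cINF_greatest[OF T(2)])
      fix u assume "u \<in> T"
      then show "z' t \<le> \<phi> u (x t, y t, z t)"
        using C(3)[of "(t, u)"] t by (simp add: \<phi>_def \<psi>_def d_def)
    qed
  qed
  have F_inc: "F (a, b, w) + \<epsilon> * (w' - w) \<le> F (a, b, w')" if "w \<le> w'" for a b w w'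
    unfolding F_def[of "(a, b, w')"]
  proof (rule cINF_greatest[OF T(2)])
    fix u assume "u \<in> T"
    then have "F (a, b, w) \<le> \<phi> u (a, b, w)"
      unfolding F_def by (rule cINF_lower[OF bdd])
    then show "F (a, b, w) + \<epsilon> * (w' - w) \<le> \<phi> u (a, b, w')"
      using g_mono[OF that, of "z u"] by (simp add: \<phi>_def)
  qed
  \<comment> \<open>Heights are interpolated linearly between the identity and \<open>F\<close>, so
    slopes on vertical lines stay at least \<open>(1 - s) + s * \<epsilon>\<close>, which is
    positive.\<close>
  define H :: "real \<Rightarrow> R3 \<Rightarrow> R3" where "H s q = (fst q, fst (snd q), (1 - s) * snd (snd q) + s * F q)" for s q
  show ?thesis
  proof (rule ambient_isotopicI[of H])
    have "continuous_on ({0..1} \<times> UNIV) (\<lambda>p::real \<times> R3. F (snd p))"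
      by (rule continuous_on_compose2[OF cont_F]) (auto intro: continuous_intros)
    then show "continuous_on ({0..1} \<times> UNIV) (\<lambda>(s, q). H s q)"
      unfolding H_def case_prod_unfold by (intro continuous_intros)
    fix s :: real assume s: "s \<in> {0..1}"
    define k where "k a b w = (1 - s) * w + s * F (a, b, w)" for a b w
    have bij_k: "bij (k a b)" for a b
    proof (rule bij_if_expanding)
      have "continuous_on UNIV (\<lambda>w. F (a, b, w))"
        by (rule continuous_on_compose2[OF cont_F]) (auto intro!: continuous_intros)
      then show "continuous_on UNIV (k a b)" unfolding k_def by (intro continuous_intros)
      show "0 < (1 - s) + s * \<epsilon>"
        using s \<epsilon> by (cases "s = 1") (auto intro: add_pos_nonneg)
      fix w w' :: real assume "w \<le> w'"
      from mult_left_mono[OF F_inc[OF this, of a b], of s] s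
      show "((1 - s) + s * \<epsilon>) * (w' - w) \<le> k a b w' - k a b w"
        by (simp add: k_def algebra_simps)
    qed
    have H_k: "H s (a, b, w) = (a, b, k a b w)" for a b w
      by (simp add: H_def k_def)
    show "bij (H s)"
    proof (rule bijI)
      show "inj (H s)"
      proof (rule injI)
        fix p q assume eq: "H s p = H s q"
        obtain a b w a' b' w' where "p = (a, b, w)" "q = (a', b', w')" by (metis prod.collapse)
        with eq show "p = q" using bij_is_inj[OF bij_k] by (auto simp: H_k inj_eq)
      qed
      have "\<exists>p. q = H s p" for q
      proof -
        obtain a b w where q: "q = (a, b, w)" by (metis prod.collapse)
        obtain v where "w = k a b v" using bij_is_surj[OF bij_k] by (metis surjD)
        then show ?thesis using H_k q by metis
      qed
      then show "surj (H s)" unfolding surj_def by blast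
    qed
  next
    show "H 1 ` (\<lambda>t. (x t, y t, z t)) ` T = (\<lambda>t. (x t, y t, z' t)) ` T"
      unfolding image_image by (rule image_cong) (auto simp: H_def F_curve)
  qed (simp add: H_def)
qed

text \<open>Over finitely many double points the positive ratios of the two height differences have
  a minimum and a maximum, which serve as \<epsilon> and L. Equal crossing signs therefore suffice
  for a vertical isotopy.\<close>

lemma ambient_isotopic_vertical_finite:
  fixes x y z z' :: "real \<Rightarrow> real"
  assumes cont: "continuous_on {0..2*pi} x" "continuous_on {0..2*pi} y"
      "continuous_on {0..2*pi} z" "continuous_on {0..2*pi} z'"
    and closed: "x (2*pi) = x 0" "y (2*pi) = y 0" "z (2*pi) = z 0" "z' (2*pi) = z' 0"
    and fin: "finite {(t, u). t \<in> {0..<2*pi} \<and> u \<in> {0..<2*pi} \<and> t \<noteq> u \<and> x t = x u \<and> y t = y u}"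
    and sgn: "\<And>t u. \<lbrakk>t \<in> {0..<2*pi}; u \<in> {0..<2*pi}; t \<noteq> u; x t = x u; y t = y u\<rbrakk> \<Longrightarrow>
      0 < (z t - z u) * (z' t - z' u)"
  shows "ambient_isotopic ((\<lambda>t. (x t, y t, z t)) ` {0..2*pi}) ((\<lambda>t. (x t, y t, z' t)) ` {0..2*pi})"
proof -
  define N where "N = {(t, u). t \<in> {0..<2*pi} \<and> u \<in> {0..<2*pi} \<and> t \<noteq> u \<and> x t = x u \<and> y t = y u}"
  define \<rho> where "\<rho> = (\<lambda>(t, u). (z' t - z' u) / (z t - z u))"
  \<comment> \<open>The entry 1 keeps \<open>Q\<close> nonempty when there are no double
    points.\<close>
  define Q where "Q = insert 1 (\<rho> ` N)"
  have Q: "finite Q" "Q \<noteq> {}" using fin by (auto simp: Q_def N_def)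
  have pos: "q > 0" if "q \<in> Q" for q
  proof (cases "q = 1")
    case False
    with that obtain t u where "(t, u) \<in> N" and q: "q = \<rho> (t, u)" by (auto simp: Q_def)
    then have "0 < (z t - z u) * (z' t - z' u)" using sgn by (simp add: N_def)
    then show ?thesis unfolding q \<rho>_def by (auto simp: zero_less_mult_iff zero_less_divide_iff)
  qed simp
  have bound: "Min Q * (z t - z u) \<le> z' t - z' u \<and> z' t - z' u \<le> Max Q * (z t - z u)"
    if tu: "t \<in> {0..<2*pi}" "u \<in> {0..<2*pi}" "x t = x u" "y t = y u" "z u \<le> z t" for t u
  proof (cases "t = u")
    case False
    then have "(t, u) \<in> N" using tu by (simp add: N_def)
    then have "\<rho> (t, u) \<in> Q" by (simp add: Q_def)
    then have "Min Q \<le> \<rho> (t, u)" "\<rho> (t, u) \<le> Max Q" using Q by auto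
    moreover have "0 < (z t - z u) * (z' t - z' u)" using sgn tu False by blast
    then have "z t - z u > 0" using tu by (simp add: zero_less_mult_iff)
    ultimately show ?thesis by (simp add: \<rho>_def field_simps)
  qed simp
  have red: "\<exists>t'\<in>{0..<2*pi}. x t' = x t \<and> y t' = y t \<and> z t' = z t \<and> z' t' = z' t"
    if "t \<in> {0..2*pi}" for t
    using that closed
    by (cases "t = 2*pi") (force intro: bexI[of _ 0], force intro: bexI[of _ t])
  show ?thesis
  proof (rule ambient_isotopic_vertical[where \<epsilon> = "Min Q" and L = "Max Q"])
    show "0 < Min Q" "Min Q \<le> Max Q" using Q pos by (simp_all add: Min.coboundedI)
    fix t u assume *: "t \<in> {0..2*pi}" "u \<in> {0..2*pi}" "x t = x u" "y t = y u" "z u \<le> z t"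
    obtain t' where t': "t' \<in> {0..<2*pi}" "x t' = x t" "y t' = y t" "z t' = z t" "z' t' = z' t"
      using red[OF *(1)] by metis
    obtain u' where "u' \<in> {0..<2*pi}" "x u' = x u" "y u' = y u" "z u' = z u" "z' u' = z' u"
      using red[OF *(2)] by metis
    with bound[of t' u'] t' * show "Min Q * (z t - z u) \<le> z' t - z' u \<and> z' t - z' u \<le> Max Q * (z t - z u)"
      by simp
  qed (use cont in auto)
qed

subsection \<open>Isotopies of the plane moving one billiard diagram to another\<close>

definition equivariant :: "(real \<Rightarrow> real) \<Rightarrow> bool" where
  "equivariant f \<longleftrightarrow> (\<forall>x. f (- x) = - f x) \<and> (\<forall>x. f (x + 2) = f x + 2)"

text \<open>These are lifts of homeomorphisms of a circle of length 2 that commute with a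
  reflection. They fix every integer, hence preserve each open unit interval; this is the range
  within which \<delta> can be moved.\<close>

definition circle_homeo :: "(real \<Rightarrow> real) \<Rightarrow> bool" where
  "circle_homeo f \<longleftrightarrow> continuous_on UNIV f \<and> strict_mono f \<and> equivariant f"

lemma equivariant_minus: "equivariant f \<Longrightarrow> f (- x) = - f x"
  by (simp add: equivariant_def)

lemma equivariant_shift:
  assumes "equivariant f"
  shows "f (x + 2 * of_int k) = f x + 2 * of_int k"
proof -
  have nat: "f (x + 2 * of_nat m) = f x + 2 * of_nat m" for x m
  proof (induction m)
    case (Suc m)
    have "f (x + 2 * of_nat (Suc m)) = f ((x + 2 * of_nat m) + 2)" by (simp add: algebra_simps)
    also have "\<dots> = f (x + 2 * of_nat m) + 2" using assms by (simp only: equivariant_def)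
    finally show ?case using Suc by simp
  qed simp
  show ?thesis
  proof (cases "k \<ge> 0")
    case True
    then show ?thesis using nat[of x "nat k"] by simp
  next
    case False
    then show ?thesis using nat[of "x + 2 * of_int k" "nat (- k)"] by simp
  qed
qed

lemma circle_homeo_bij:
  assumes "circle_homeo f"
  shows "bij f"
proof (rule bijI)
  show "inj f" using assms by (simp add: circle_homeo_def strict_mono_on_imp_inj_on)
  have "\<exists>x. y = f x" for y
  proof -
    have f0: "f 0 = 0" using assms equivariant_minus[of f 0] by (simp add: circle_homeo_def)
    have fi: "f (2 * of_int k) = 2 * of_int k" for k
      using assms equivariant_shift[of f 0 k] f0 by (simp add: circle_homeo_def)
    \<comment> \<open>Even integers are fixed, so the values at plus and minus \<open>2 * k\<close>
      bracket \<open>y\<close>.\<close>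
    define k where "k = \<lceil>\<bar>y\<bar>\<rceil>"
    have k: "\<bar>y\<bar> \<le> of_int k" "k \<ge> 0" by (simp_all add: k_def)
    have "\<exists>x\<ge>2 * of_int (- k). x \<le> 2 * of_int k \<and> f x = y"
    proof (rule IVT')
      show "f (2 * of_int (- k)) \<le> y" "y \<le> f (2 * of_int k)" unfolding fi using k by auto
      show "continuous_on {2 * of_int (- k)..2 * of_int k} f"
        using assms continuous_on_subset by (auto simp: circle_homeo_def)
    qed (use k in auto)
    then show ?thesis by auto
  qed
  then show "surj f" unfolding surj_def by blast
qed

lemma equivariant_inv:
  assumes "equivariant f" "bij f"
  shows "equivariant (inv f)"
  unfolding equivariant_def
proof safe
  have s: "f (inv f x) = x" and i: "inv f (f x) = x" for x
    using assms(2) by (simp_all add: bij_is_surj surj_f_inv_f bij_is_inj)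
  show "inv f (- x) = - inv f x" for x
    using equivariant_minus[OF assms(1), of "inv f x"] s[of x] i[of "- inv f x"] by simp
  show "inv f (x + 2) = inv f x + 2" for x
    using equivariant_shift[OF assms(1), of "inv f x" 1] s[of x] i[of "inv f x + 2"] by simp
qed

text \<open>The class is convex, so each member is joined to the identity inside it; this path
  supplies the time parameter of the planar isotopy.\<close>

lemma circle_homeo_interpolate:
  assumes "circle_homeo f" and s: "s \<in> {0..1}"
  shows "circle_homeo (\<lambda>x. (1 - s) * x + s * f x)"
proof -
  have "strict_mono (\<lambda>x. (1 - s) * x + s * f x)"
  proof (rule strict_monoI)
    fix x y :: real assume "x < y"
    then have "f x < f y" using assms by (simp add: circle_homeo_def strict_mono_def)
    show "(1 - s) * x + s * f x < (1 - s) * y + s * f y"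
    proof (cases "s = 0")
      case False
      then have "s * f x < s * f y" using s \<open>f x < f y\<close> by simp
      moreover have "(1 - s) * x \<le> (1 - s) * y" using s \<open>x < y\<close> by (intro mult_left_mono) auto
      ultimately show ?thesis by linarith
    qed (use \<open>x < y\<close> in simp)
  qed
  moreover have "equivariant (\<lambda>x. (1 - s) * x + s * f x)"
    using assms by (auto simp: circle_homeo_def equivariant_def algebra_simps)
  ultimately show ?thesis
    using assms by (auto simp: circle_homeo_def intro!: continuous_intros)
qed

lemma circle_homeo_compose: "circle_homeo f \<Longrightarrow> circle_homeo g \<Longrightarrow> circle_homeo (\<lambda>x. g (f x))"
  by (auto simp: circle_homeo_def equivariant_def strict_mono_def intro: continuous_on_compose2)

text \<open>The sine term is odd, 2-periodic and Lipschitz with constant |c| pi < 1, so adding it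
  keeps both symmetries and strict monotonicity.\<close>

lemma circle_homeo_sin:
  assumes "\<bar>c\<bar> * pi < 1"
  shows "circle_homeo (\<lambda>x. x + c * sin (pi * x))"
proof -
  have "strict_mono (\<lambda>x. x + c * sin (pi * x))"
  proof (rule strict_monoI)
    fix x y :: real assume xy: "x < y"
    have "\<bar>sin (pi * y) - sin (pi * x)\<bar> \<le> 2 * \<bar>sin ((pi * y - pi * x) / 2)\<bar>"
      unfolding sin_diff_sin abs_mult using abs_cos_le_one by (simp add: mult_left_le)
    also have "\<dots> \<le> pi * (y - x)"
      using abs_sin_x_le_abs_x[of "(pi * y - pi * x) / 2"] xy by (simp add: algebra_simps)
    finally have "\<bar>c\<bar> * \<bar>sin (pi * y) - sin (pi * x)\<bar> \<le> \<bar>c\<bar> * pi * (y - x)"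
      by (simp add: mult_left_mono mult.assoc)
    also have "\<dots> < y - x" using assms xy by simp
    finally have "\<bar>c * (sin (pi * y) - sin (pi * x))\<bar> < y - x" by (simp add: abs_mult)
    then show "x + c * sin (pi * x) < y + c * sin (pi * y)" by (simp add: algebra_simps abs_if split: if_splits)
  qed
  moreover have "sin (pi * (x + 2)) = sin (pi * x)" for x
    using sin_periodic[of "pi * x"] by (simp add: algebra_simps)
  ultimately show ?thesis
    by (auto simp: circle_homeo_def equivariant_def intro!: continuous_intros)
qed

text \<open>Sine perturbations move a non-integral point to every nearby point. Mutual reachability
  is thus an equivalence relation with open classes on a connected interval, which leaves a single
  class.\<close>

lemma circle_homeo_moves:
  fixes m :: int
  assumes a: "of_int m < a" "a < of_int m + 1" and b: "of_int m < b" "b < of_int m + 1"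
  obtains f where "circle_homeo f" "f a = b"
proof -
  define R where "R a b \<longleftrightarrow> (\<exists>f. circle_homeo f \<and> f a = b) \<and> (\<exists>f. circle_homeo f \<and> f b = a)" for a b
  have local: "\<exists>f. circle_homeo f \<and> f a = b" if "\<bar>b - a\<bar> * pi < \<bar>sin (pi * a)\<bar>" for a b
  proof -
    define c where "c = (b - a) / sin (pi * a)"
    have nz: "sin (pi * a) \<noteq> 0" using that by (metis abs_0 abs_ge_zero mult_nonneg_nonneg not_le pi_ge_zero)
    have "\<bar>c\<bar> * pi < 1" using that nz by (simp add: c_def field_simps)
    moreover have "a + c * sin (pi * a) = b" using nz by (simp add: c_def)
    ultimately show ?thesis using circle_homeo_sin by blast
  qed
  have sin_nz: "sin (pi * x) \<noteq> 0" if "x \<in> {of_int m<..<of_int m + 1}" for x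
  proof
    assume "sin (pi * x) = 0"
    then obtain i :: int where "x = of_int i" by (auto simp: sin_zero_iff_int2 mult.commute)
    with that have "m < i" "i < m + 1" by auto
    then show False by linarith
  qed
  have "R a b"
  proof (rule connected_equivalence_relation[of "{of_int m<..<of_int m + 1}"])
    have trans: "\<exists>h. circle_homeo h \<and> h x = z"
      if fg: "\<exists>f. circle_homeo f \<and> f x = y" "\<exists>g. circle_homeo g \<and> g y = z" for x y z
    proof -
      obtain f g where "circle_homeo f" "f x = y" "circle_homeo g" "g y = z" using fg by blast
      then show ?thesis using circle_homeo_compose by (intro exI[of _ "\<lambda>w. g (f w)"]) simp
    qed
    show "R x z" if "R x y" "R y z" for x y z
      using that trans[of x y z] trans[of z y x] unfolding R_def by simp
    fix x :: real assume x: "x \<in> {of_int m<..<of_int m + 1}"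
    \<comment> \<open>The two conditions make the perturbation small enough both from
      \<open>x\<close> to \<open>y\<close> and back.\<close>
    define U where "U = {y. \<bar>y - x\<bar> * pi < \<bar>sin (pi * x)\<bar>} \<inter> {y. \<bar>y - x\<bar> * pi < \<bar>sin (pi * y)\<bar>}"
    define T where "T = {of_int m<..<of_int m + 1} \<inter> U"
    have "open U"
      unfolding U_def by (intro open_Int open_Collect_less continuous_intros)
    then have "openin (top_of_set {of_int m<..<of_int m + 1}) T"
      unfolding openin_open T_def by blast
    moreover have "x \<in> T" using x sin_nz[OF x] by (simp add: T_def U_def)
    moreover have "R x y" if "y \<in> T" for y
      using that local[of y x] local[of x y] by (auto simp: T_def U_def R_def abs_minus_commute)
    ultimately show "\<exists>T. openin (top_of_set {of_int m<..<of_int m + 1}) T \<and> x \<in> T \<and> (\<forall>y\<in>T. R x y)"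
      by blast
  qed (use a b in \<open>auto simp: R_def\<close>)
  then show ?thesis using that by (auto simp: R_def)
qed

section \<open>The plane map induced by a circle homeomorphism\<close>

lemma cos_add_2pi_int: "cos (x + 2 * pi * of_int k) = cos x"
  by (simp add: cos_add)

definition clamp1 :: "real \<Rightarrow> real" where "clamp1 x = max (- 1) (min 1 x)"

lemma clamp1_bounds [simp]: "- 1 \<le> clamp1 x" "clamp1 x \<le> 1"
  by (auto simp: clamp1_def)

lemma clamp1_id: "- 1 \<le> x \<Longrightarrow> x \<le> 1 \<Longrightarrow> clamp1 x = x"
  by (auto simp: clamp1_def)

text \<open>
  Put \<open>x = cos X\<close>, \<open>y = cos Y\<close>, \<open>u = (M X - N Y) / \<pi>\<close>, \<open>v = (M X + N Y) / \<pi>\<close>. The planar Lissajous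
  curve with frequencies \<open>N\<close>, \<open>M\<close> then consists of the lines where \<open>u\<close> or \<open>v\<close> lies in \<open>\<plusminus>\<delta> + 2\<int>\<close>, and
  \<open>fold_x\<close>, \<open>fold_y\<close> are the coordinates of the point with \<open>(u, v)\<close> replaced by \<open>(f u, f v)\<close>.
  Equivariance of \<open>f\<close> makes this compatible with the symmetries of the cosine.
\<close>

definition fold_x :: "int \<Rightarrow> int \<Rightarrow> (real \<Rightarrow> real) \<Rightarrow> real \<Rightarrow> real \<Rightarrow> real" where
  "fold_x N M f X Y = cos (pi * (f ((M * X - N * Y) / pi) + f ((M * X + N * Y) / pi)) / (2 * real_of_int M))"

definition fold_y :: "int \<Rightarrow> int \<Rightarrow> (real \<Rightarrow> real) \<Rightarrow> real \<Rightarrow> real \<Rightarrow> real" where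
  "fold_y N M f X Y = cos (pi * (f ((M * X + N * Y) / pi) - f ((M * X - N * Y) / pi)) / (2 * real_of_int N))"

context
  fixes N M :: int
  assumes pos: "N > 0" "M > 0"
begin

text \<open>The pair (u, v) becomes (-v, -u). As f is odd, f u + f v changes sign, which the cosine
  ignores, and f v - f u stays.\<close>

lemma fold_minus_x:
  assumes "equivariant f"
  shows "fold_x N M f (- X) Y = fold_x N M f X Y" "fold_y N M f (- X) Y = fold_y N M f X Y"
proof -
  have u: "(M * (- X) - N * Y) / pi = - ((M * X + N * Y) / pi)"
    and v: "(M * (- X) + N * Y) / pi = - ((M * X - N * Y) / pi)"
    by (simp_all add: field_simps)
  have *: "pi * (- a + - b) / c = - (pi * (b + a) / c)" "- a - - b = b - a" for a b c :: real
    by (cases "c = 0"; simp add: field_simps)+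
  show "fold_x N M f (- X) Y = fold_x N M f X Y" "fold_y N M f (- X) Y = fold_y N M f X Y"
    unfolding fold_x_def fold_y_def u v equivariant_minus[OF assms] * cos_minus by simp_all
qed

text \<open>Here u and v are exchanged.\<close>

lemma fold_minus_y:
  shows "fold_x N M f X (- Y) = fold_x N M f X Y" "fold_y N M f X (- Y) = fold_y N M f X Y"
proof -
  have u: "(M * X - N * (- Y)) / pi = (M * X + N * Y) / pi"
    and v: "(M * X + N * (- Y)) / pi = (M * X - N * Y) / pi"
    by (simp_all add: field_simps)
  have *: "pi * (a - b) / c = - (pi * (b - a) / c)" for a b c :: real
    by (cases "c = 0"; simp add: field_simps)
  show "fold_x N M f X (- Y) = fold_x N M f X Y"
    unfolding fold_x_def u v by (simp add: add.commute)
  show "fold_y N M f X (- Y) = fold_y N M f X Y"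
    unfolding fold_y_def u v by (subst *) (simp only: cos_minus)
qed

text \<open>Both u and v grow by 2 M k, which shifts the first angle by a full multiple of 2 pi and
  cancels in the second.\<close>

lemma fold_shift_x:
  assumes "equivariant f"
  shows "fold_x N M f (X + 2 * of_int k * pi) Y = fold_x N M f X Y"
    and "fold_y N M f (X + 2 * of_int k * pi) Y = fold_y N M f X Y"
proof -
  have u: "(M * (X + 2 * of_int k * pi) - N * Y) / pi = (M * X - N * Y) / pi + 2 * of_int (M * k)"
    and v: "(M * (X + 2 * of_int k * pi) + N * Y) / pi = (M * X + N * Y) / pi + 2 * of_int (M * k)"
    by (simp_all add: field_simps)
  have *: "pi * ((a + 2 * of_int (M * k)) + (b + 2 * of_int (M * k))) / (2 * real_of_int M)
     = pi * (a + b) / (2 * real_of_int M) + 2 * pi * of_int k" for a b :: real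
    using pos by (simp add: field_simps)
  show "fold_x N M f (X + 2 * of_int k * pi) Y = fold_x N M f X Y"
    unfolding fold_x_def u v equivariant_shift[OF assms] * cos_add_2pi_int ..
  show "fold_y N M f (X + 2 * of_int k * pi) Y = fold_y N M f X Y"
    unfolding fold_y_def u v equivariant_shift[OF assms] by simp
qed

text \<open>Here u and v change by opposite amounts, so the roles of the two angles are
  exchanged.\<close>

lemma fold_shift_y:
  assumes "equivariant f"
  shows "fold_x N M f X (Y + 2 * of_int k * pi) = fold_x N M f X Y"
    and "fold_y N M f X (Y + 2 * of_int k * pi) = fold_y N M f X Y"
proof -
  have u: "(M * X - N * (Y + 2 * of_int k * pi)) / pi = (M * X - N * Y) / pi + 2 * of_int (- (N * k))"
    and v: "(M * X + N * (Y + 2 * of_int k * pi)) / pi = (M * X + N * Y) / pi + 2 * of_int (N * k)"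
    by (simp_all add: field_simps)
  have *: "pi * ((a + 2 * of_int (N * k)) - (b + 2 * of_int (- (N * k)))) / (2 * real_of_int N)
     = pi * (a - b) / (2 * real_of_int N) + 2 * pi * of_int k" for a b :: real
    using pos by (simp add: field_simps)
  show "fold_x N M f X (Y + 2 * of_int k * pi) = fold_x N M f X Y"
    unfolding fold_x_def u v equivariant_shift[OF assms] by simp
  show "fold_y N M f X (Y + 2 * of_int k * pi) = fold_y N M f X Y"
    unfolding fold_y_def u v equivariant_shift[OF assms] * cos_add_2pi_int ..
qed

text \<open>Sign changes and shifts by 2 pi account for all angles with equal cosine. The fold is
  therefore a function of cos X and cos Y, and the branch chosen by \<open>arccos\<close> in
  \<open>plane_map\<close> is immaterial.\<close>

lemma fold_cong:
  assumes f: "equivariant f" and "cos X = cos X'" "cos Y = cos Y'"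
  shows "fold_x N M f X Y = fold_x N M f X' Y'" "fold_y N M f X Y = fold_y N M f X' Y'"
proof -
  obtain i :: int where "X = X' + 2 * of_int i * pi \<or> X = - X' + 2 * of_int i * pi"
    using assms(2) unfolding cos_eq Ints_def by blast
  moreover obtain j :: int where "Y = Y' + 2 * of_int j * pi \<or> Y = - Y' + 2 * of_int j * pi"
    using assms(3) unfolding cos_eq Ints_def by blast
  ultimately show "fold_x N M f X Y = fold_x N M f X' Y'" "fold_y N M f X Y = fold_y N M f X' Y'"
    by (auto simp only: fold_shift_x[OF f] fold_shift_y[OF f] fold_minus_x[OF f] fold_minus_y)
qed

text \<open>
  The self-map of the square given by \<open>fold_x\<close> and \<open>fold_y\<close> in the coordinates \<open>x = cos X\<close>, \<open>y = cos Y\<close>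
  preserves the four sides, so it extends to the plane by translating along the outer normals.
\<close>

definition plane_map :: "(real \<Rightarrow> real) \<Rightarrow> R3 \<Rightarrow> R3" where
  "plane_map f p =
    (fold_x N M f (arccos (clamp1 (fst p))) (arccos (clamp1 (fst (snd p)))) + (fst p - clamp1 (fst p)),
     fold_y N M f (arccos (clamp1 (fst p))) (arccos (clamp1 (fst (snd p)))) + (fst (snd p) - clamp1 (fst (snd p))),
     snd (snd p))"

lemma plane_map_cos:
  assumes "equivariant f"
  shows "plane_map f (cos X, cos Y, z) = (fold_x N M f X Y, fold_y N M f X Y, z)"
  using fold_cong[OF assms, of "arccos (cos X)" X "arccos (cos Y)" Y]
  by (simp add: plane_map_def clamp1_id)

text \<open>On the sides X = 0 and X = pi one has u = -v and u = -v + 2 M, so f u + f v is 0 and 2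
  M.\<close>

lemma fold_x_boundary:
  assumes f: "equivariant f" and "cos X = 1 \<or> cos X = - 1"
  shows "fold_x N M f X Y = cos X"
proof -
  have "fold_x N M f 0 Y = 1"
    using equivariant_minus[OF f, of "N * Y / pi"] by (simp add: fold_x_def)
  moreover have "fold_x N M f pi Y = - 1"
  proof -
    have "(M * pi - N * Y) / pi = - ((M * pi + N * Y) / pi) + 2 * of_int M"
      by (simp add: field_simps)
    then have "f ((M * pi - N * Y) / pi) = - f ((M * pi + N * Y) / pi) + 2 * of_int M"
      by (simp only: equivariant_shift[OF f] equivariant_minus[OF f])
    then have "fold_x N M f pi Y = cos (pi * (2 * of_int M) / (2 * real_of_int M))"
      by (simp add: fold_x_def)
    then show ?thesis using pos by simp
  qed
  ultimately show ?thesis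
    using assms(2) fold_cong(1)[OF f, of X 0 Y Y] fold_cong(1)[OF f, of X pi Y Y] by auto
qed

text \<open>On the sides Y = 0 and Y = pi one has v = u and v = u + 2 N.\<close>

lemma fold_y_boundary:
  assumes f: "equivariant f" and "cos Y = 1 \<or> cos Y = - 1"
  shows "fold_y N M f X Y = cos Y"
proof -
  have "fold_y N M f X 0 = 1" by (simp add: fold_y_def)
  moreover have "fold_y N M f X pi = - 1"
  proof -
    have "(M * X + N * pi) / pi = (M * X - N * pi) / pi + 2 * of_int N"
      by (simp add: field_simps)
    then have "f ((M * X + N * pi) / pi) = f ((M * X - N * pi) / pi) + 2 * of_int N"
      by (simp only: equivariant_shift[OF f])
    then have "fold_y N M f X pi = cos (pi * (2 * of_int N) / (2 * real_of_int N))"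
      by (simp add: fold_y_def)
    then show ?thesis using pos by simp
  qed
  ultimately show ?thesis
    using assms(2) fold_cong(2)[OF f, of X X Y 0] fold_cong(2)[OF f, of X X Y pi] by auto
qed

lemma plane_map_inverse:
  assumes f: "equivariant f" and g: "equivariant g" and gf: "\<And>x. g (f x) = x"
  shows "plane_map g (plane_map f p) = p"
proof -
  obtain x y z where p: "p = (x, y, z)" by (metis prod.collapse)
  define X Y where "X = arccos (clamp1 x)" and "Y = arccos (clamp1 y)"
  define u v where "u = (M * X - N * Y) / pi" and "v = (M * X + N * Y) / pi"
  have cX: "cos X = clamp1 x" and cY: "cos Y = clamp1 y" by (simp_all add: X_def Y_def)
  \<comment> \<open>The clamped part can be read off the image: if the translation is nonzero,
    \<open>w\<close> lies outside the square's range and \<open>c\<close> is the same endpoint as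
    \<open>clamp1 w\<close>.\<close>
  have ends: "clamp1 (c + (w - clamp1 w)) = c"
    if "- 1 \<le> c" "c \<le> 1" "clamp1 w = 1 \<or> clamp1 w = - 1 \<Longrightarrow> c = clamp1 w" for c w
    using that by (auto simp: clamp1_def max_def min_def split: if_splits)
  define x1 y1 where "x1 = fold_x N M f X Y" and "y1 = fold_y N M f X Y"
  have pf: "plane_map f p = (x1 + (x - clamp1 x), y1 + (y - clamp1 y), z)"
    by (simp add: plane_map_def p X_def Y_def x1_def y1_def)
  have c1: "clamp1 (x1 + (x - clamp1 x)) = x1"
    by (rule ends) (use fold_x_boundary[OF f, of X Y] in \<open>auto simp: x1_def cX[symmetric] fold_x_def[of N M f X Y]\<close>)
  have c2: "clamp1 (y1 + (y - clamp1 y)) = y1"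
    by (rule ends) (use fold_y_boundary[OF f, of Y X] in \<open>auto simp: y1_def cY[symmetric] fold_y_def[of N M f X Y]\<close>)
  \<comment> \<open>These angles of the image point have (u, v)-coordinates exactly
    \<open>f u\<close> and \<open>f v\<close>, so \<open>g\<close> recovers \<open>u\<close> and
    \<open>v\<close>.\<close>
  define X1 Y1 where "X1 = pi * (f u + f v) / (2 * real_of_int M)" and "Y1 = pi * (f v - f u) / (2 * real_of_int N)"
  have x1: "x1 = cos X1" and y1: "y1 = cos Y1"
    by (simp_all add: x1_def y1_def X1_def Y1_def fold_x_def fold_y_def u_def v_def)
  have MX: "M * X1 = pi * (f u + f v) / 2" and NY: "N * Y1 = pi * (f v - f u) / 2"
    using pos by (simp_all add: X1_def Y1_def)
  have uv: "(M * X1 - N * Y1) / pi = f u" "(M * X1 + N * Y1) / pi = f v"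
    unfolding MX NY by (simp_all add: field_simps)
  have XY: "pi * (u + v) / (2 * real_of_int M) = X" "pi * (v - u) / (2 * real_of_int N) = Y"
    using pos by (simp_all add: u_def v_def field_simps)
  have "fold_x N M g X1 Y1 = clamp1 x" "fold_y N M g X1 Y1 = clamp1 y"
    unfolding fold_x_def fold_y_def uv gf XY cX cY by simp_all
  moreover have "fold_x N M g (arccos x1) (arccos y1) = fold_x N M g X1 Y1"
    "fold_y N M g (arccos x1) (arccos y1) = fold_y N M g X1 Y1"
    by (intro fold_cong[OF g]; simp add: x1 y1)+
  ultimately show ?thesis
    unfolding pf by (simp add: plane_map_def c1 c2 p)
qed

lemma ambient_isotopic_plane_map:
  assumes f: "circle_homeo f"
  shows "ambient_isotopic A (plane_map f ` A)"
proof (rule ambient_isotopicI[of "\<lambda>s. plane_map (\<lambda>x. (1 - s) * x + s * f x)"])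
  have cf: "continuous_on UNIV f" using f by (simp add: circle_homeo_def)
  have cc: "continuous_on UNIV clamp1" unfolding clamp1_def by (intro continuous_intros)
  have pos': "real_of_int M \<noteq> 0" "real_of_int N \<noteq> 0" using pos by auto
  show "continuous_on ({0..1} \<times> UNIV) (\<lambda>(s, p). plane_map (\<lambda>x. (1 - s) * x + s * f x) p)"
    unfolding plane_map_def fold_x_def fold_y_def case_prod_unfold
    by (intro continuous_intros continuous_on_compose2[OF cf] continuous_on_compose2[OF cc])
       (use pos' in auto)
  show "plane_map (\<lambda>x. (1 - 0) * x + 0 * f x) p = p" for p
  proof -
    have "pi * ((M * X - N * Y) / pi + (M * X + N * Y) / pi) / (2 * real_of_int M) = X"
      "pi * ((M * X + N * Y) / pi - (M * X - N * Y) / pi) / (2 * real_of_int N) = Y" for X Y :: real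
      using pos' by (simp_all add: field_simps)
    then show ?thesis by (simp add: plane_map_def fold_x_def fold_y_def)
  qed
  show "bij (plane_map (\<lambda>x. (1 - s) * x + s * f x))" if s: "s \<in> {0..1}" for s
  proof -
    define h where "h = (\<lambda>x. (1 - s) * x + s * f x)"
    have h: "circle_homeo h" unfolding h_def by (rule circle_homeo_interpolate[OF f s])
    have b: "bij h" by (rule circle_homeo_bij[OF h])
    have eh: "equivariant h" using h by (simp add: circle_homeo_def)
    have ei: "equivariant (inv h)" by (rule equivariant_inv[OF eh b])
    \<comment> \<open>The inverse of each stage is the plane map of the inverse circle
      homeomorphism.\<close>
    have "plane_map (inv h) \<circ> plane_map h = id" "plane_map h \<circ> plane_map (inv h) = id"
      using plane_map_inverse[OF eh ei] plane_map_inverse[OF ei eh] b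
      by (auto simp: fun_eq_iff bij_is_inj bij_is_surj surj_f_inv_f simp del: split_paired_All)
    then show ?thesis unfolding h_def[symmetric] by (rule o_bij)
  qed
  show "plane_map (\<lambda>x. (1 - 1) * x + 1 * f x) ` A = plane_map f ` A" by simp
qed

end

subsection \<open>Crossings of Lissajous curves\<close>

text \<open>Each equality of cosines determines either t - u or t + u modulo a period. Two
  conditions on t - u give a full period by coprimality, mixed ones give the two families of
  crossings, and two conditions on t + u are compatible only for an integral \<delta>.\<close>

lemma cos_coincidence:
  fixes p q :: int and a b t u :: real
  assumes pos: "p > 0" "q > 0" and cop: "coprime p q"
    and eq: "cos (p * t + a) = cos (p * u + a)" "cos (q * t + b) = cos (q * u + b)"
  obtains (same) k :: int where "t - u = 2 * pi * k"
    | (first) k l :: int where "\<not> p dvd k" "t - u = 2 * pi * k / p" "t + u = (2 * pi * l - 2 * b) / q"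
    | (second) k l :: int where "\<not> q dvd k" "t - u = 2 * pi * k / q" "t + u = (2 * pi * l - 2 * a) / p"
    | (degenerate) i :: int where "q * a - p * b = pi * i"
proof -
  obtain i :: int where i: "p * t + a = p * u + a + 2 * of_int i * pi \<or> p * t + a = - (p * u + a) + 2 * of_int i * pi"
    using eq(1) unfolding cos_eq Ints_def by blast
  obtain j :: int where j: "q * t + b = q * u + b + 2 * of_int j * pi \<or> q * t + b = - (q * u + b) + 2 * of_int j * pi"
    using eq(2) unfolding cos_eq Ints_def by blast
  have multiple: thesis if "t - u = 2 * pi * k / n" "n dvd k" "n > 0" for k n :: int
  proof -
    from that(2) obtain k' where "k = n * k'" by blast
    with that show thesis by (intro same[of k']) simp
  qed
  from i j show thesis
  proof (elim disjE)
    assume ii: "p * t + a = p * u + a + 2 * of_int i * pi" and jj: "q * t + b = q * u + b + 2 * of_int j * pi"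
    have "p * (t - u) = 2 * pi * i" "q * (t - u) = 2 * pi * j"
      using ii jj by (simp_all add: algebra_simps)
    then have "q * (2 * pi * i) = p * (2 * pi * j)" by (metis mult.left_commute)
    then have "real_of_int (q * i) = real_of_int (p * j)" by simp
    then have "q * i = p * j" by (simp only: of_int_eq_iff)
    then have "p dvd i" using cop by (metis coprime_dvd_mult_right_iff dvd_triv_left)
    then show thesis using multiple[of i p] ii pos by (simp add: field_simps)
  next
    assume ii: "p * t + a = p * u + a + 2 * of_int i * pi" and jj: "q * t + b = - (q * u + b) + 2 * of_int j * pi"
    have "t - u = 2 * pi * i / p" "t + u = (2 * pi * j - 2 * b) / q"
      using ii jj pos by (simp_all add: field_simps)
    then show thesis using multiple[of i p] first[of i j] pos by blast
  next
    assume ii: "p * t + a = - (p * u + a) + 2 * of_int i * pi" and jj: "q * t + b = q * u + b + 2 * of_int j * pi"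
    have "t - u = 2 * pi * j / q" "t + u = (2 * pi * i - 2 * a) / p"
      using ii jj pos by (simp_all add: field_simps)
    then show thesis using multiple[of j q] second[of j i] pos by blast
  next
    assume ii: "p * t + a = - (p * u + a) + 2 * of_int i * pi" and jj: "q * t + b = - (q * u + b) + 2 * of_int j * pi"
    have "p * (t + u) = 2 * pi * i - 2 * a" "q * (t + u) = 2 * pi * j - 2 * b"
      using ii jj by (simp_all add: algebra_simps)
    then have "q * (2 * pi * i - 2 * a) = p * (2 * pi * j - 2 * b)" by (metis mult.left_commute)
    then have "q * a - p * b = pi * of_int (q * i - p * j)" by (simp add: algebra_simps)
    then show thesis by (rule degenerate)
  qed
qed

lemma crossing_coincidence:
  fixes p q k l :: int and a b t u :: real
  assumes pos: "p > 0" "q > 0"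
    and tu: "t - u = 2 * pi * k / p" "t + u = (2 * pi * l - 2 * b) / q"
  shows "cos (p * t + a) = cos (p * u + a)" "cos (q * t + b) = cos (q * u + b)"
proof -
  have "p * t + a = p * u + a + 2 * of_int k * pi" "q * t + b = - (q * u + b) + 2 * of_int l * pi"
    using tu pos by (simp_all add: field_simps)
  then show "cos (p * t + a) = cos (p * u + a)" "cos (q * t + b) = cos (q * u + b)"
    unfolding cos_eq by auto
qed

text \<open>The product formula separates a factor depending only on the time difference from one
  governed by (q c - n b) / pi, which is A or B according to the family of crossings.\<close>

lemma height_difference:
  fixes p q n k l :: int and b c t u :: real
  assumes pos: "p > 0" "q > 0"
    and tu: "t - u = 2 * pi * k / p" "t + u = (2 * pi * l - 2 * b) / q"
  shows "cos (n * t + c) - cos (n * u + c)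
    = - 2 * sin (pi * ((q * c - n * b) / pi + n * l) / q) * sin (pi * n * k / p)"
proof -
  have 1: "((n * t + c) + (n * u + c)) / 2 = pi * ((q * c - n * b) / pi + n * l) / q"
  proof -
    have "((n * t + c) + (n * u + c)) / 2 = n * (t + u) / 2 + c" by (simp add: field_simps)
    also have "\<dots> = pi * ((q * c - n * b) / pi + n * l) / q"
      unfolding tu(2) using pos by (simp add: field_simps)
    finally show ?thesis .
  qed
  have 2: "((n * u + c) - (n * t + c)) / 2 = - (pi * n * k / p)"
  proof -
    have "((n * u + c) - (n * t + c)) / 2 = - (n * (t - u) / 2)" by (simp add: field_simps)
    also have "\<dots> = - (pi * n * k / p)" unfolding tu(1) by simp
    finally show ?thesis .
  qed
  show ?thesis unfolding cos_diff_cos 1 2 by simp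
qed

lemma sin_ratio_nonzero:
  fixes n k p :: int
  assumes "p > 0" "coprime p n" "\<not> p dvd k"
  shows "sin (pi * n * k / p) \<noteq> 0"
proof
  assume "sin (pi * n * k / p) = 0"
  then obtain i :: int where "pi * n * k / p = of_int i * pi" by (auto simp: sin_zero_iff_int2)
  then have "real_of_int (n * k) = real_of_int (i * p)" using assms(1) by (simp add: field_simps)
  then have "n * k = i * p" by (simp only: of_int_eq_iff)
  then have "p dvd n * k" by simp
  with assms show False by (simp add: coprime_dvd_mult_right_iff)
qed

lemma sin_add_2pi_int: "sin (x + 2 * pi * of_int k) = sin x"
  by (simp add: sin_add)

text \<open>The zeros are multiples of q, in particular integers, so the sign is constant on an open
  unit interval.\<close>

lemma sin_same_cell:
  fixes i q :: int and x y :: real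
  assumes q: "q > 0" and x: "i < x" "x < i + 1" and y: "i < y" "y < i + 1"
  shows "0 < sin (pi * x / q) * sin (pi * y / q)"
proof -
  \<comment> \<open>\<open>d\<close> numbers the half-wave of length \<open>q\<close> that contains
    the unit interval.\<close>
  define d where "d = i div q"
  have d: "q * d \<le> i" "i + 1 \<le> q * d + q"
    using q mult_div_mod_eq[of q i] pos_mod_sign[OF q, of i] pos_mod_bound[OF q, of i]
    unfolding d_def by linarith+
  have shift: "sin (pi * w / q) = (if even d then 1 else - 1) * sin (pi * (w - q * d) / q)" for w :: real
  proof -
    have e: "pi * w / q = pi * (w - q * d) / q + pi * d" using q by (simp add: field_simps)
    show ?thesis unfolding e sin_add by (simp add: cos_npi_int mult.commute)
  qed
  have pos: "0 < sin (pi * (w - q * d) / q)" if "i < w" "w < i + 1" for w :: real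
  proof (rule sin_gt_zero)
    have "real_of_int (q * d) \<le> real_of_int i" "real_of_int (i + 1) \<le> real_of_int (q * d + q)"
      using d by (simp_all only: of_int_le_iff)
    then have "0 < w - q * d" "w - q * d < q" using that by auto
    then show "0 < pi * (w - q * d) / q" "pi * (w - q * d) / q < pi"
      using q by (simp_all add: pos_divide_less_eq)
  qed
  show ?thesis using pos[OF x] pos[OF y] unfolding shift[of x] shift[of y] by auto
qed

text \<open>Changing the frequency by 2 q r or A' by 2 q e changes the argument of the sine by a
  multiple of 2 pi.\<close>

lemma crossing_sign:
  fixes q n n' r i e l :: int and A A' :: real
  assumes q: "q > 0" and A: "i < A" "A < i + 1" and A': "i < A' + 2 * q * e" "A' + 2 * q * e < i + 1"
    and n': "n' = n + 2 * q * r"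
  shows "0 < sin (pi * (A + n * l) / q) * sin (pi * (A' + n' * l) / q)"
proof -
  have e: "pi * (A' + n' * l) / q = pi * ((A' + 2 * q * e) + n * l) / q + 2 * pi * of_int (r * l - e)"
    using q by (simp add: n' field_simps)
  show ?thesis
    unfolding e sin_add_2pi_int
    by (rule sin_same_cell[of q "i + n * l"]) (use q A A' in auto)
qed

section \<open>Finiteness of the set of crossings\<close>

lemma finite_crossings_aux:
  fixes p q :: int and b :: real
  assumes pos: "p > 0" "q > 0"
  shows "finite {(t :: real, u :: real). t \<in> {0..<2*pi} \<and> u \<in> {0..<2*pi} \<and>
    (\<exists>(k::int) (l::int). t - u = 2 * pi * k / p \<and> t + u = (2 * pi * l - 2 * b) / q)}" (is "finite ?S")
proof -
  \<comment> \<open>The indices \<open>k\<close> and \<open>l\<close> determine the times, and both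
    are bounded because the times lie in one period.\<close>
  define g where "g = (\<lambda>(k :: int, l :: int).
    (((2 * pi * l - 2 * b) / q + 2 * pi * k / p) / 2, ((2 * pi * l - 2 * b) / q - 2 * pi * k / p) / 2))"
  have "?S \<subseteq> g ` ({- p..p} \<times> {\<lfloor>b / pi\<rfloor>..\<lceil>2 * q + b / pi\<rceil>})"
  proof (rule subsetI)
    fix x assume "x \<in> ?S"
    then obtain t u :: real and k l :: int
      where x: "x = (t, u)" and t: "t \<in> {0..<2*pi}" and u: "u \<in> {0..<2*pi}"
      and k: "t - u = 2 * pi * k / p" and l: "t + u = (2 * pi * l - 2 * b) / q" by blast
    have "2 * pi * k = (t - u) * p" using k pos by simp
    moreover have "(t - u) * p < (2 * pi) * p" "(- (2 * pi)) * p < (t - u) * p"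
      using t u pos by (intro mult_strict_right_mono; simp)+
    ultimately have "(2 * pi) * of_int k < (2 * pi) * of_int p" "(2 * pi) * of_int (- p) < (2 * pi) * of_int k"
      by auto
    then have "real_of_int k < of_int p" "real_of_int (- p) < of_int k"
      by (simp_all only: mult_less_cancel_left_pos pi_gt_zero zero_less_mult_iff zero_less_numeral simp_thms)
    then have kp: "k \<in> {- p..p}" by (simp only: of_int_less_iff atLeastAtMost_iff less_imp_le simp_thms)
    have "2 * pi * l - 2 * b = (t + u) * q" using l pos by simp
    moreover have "0 \<le> (t + u) * q" "(t + u) * q \<le> (4 * pi) * q"
      using t u pos by (auto intro!: mult_right_mono)
    ultimately have "b / pi \<le> l" "l \<le> 2 * q + b / pi" by (auto simp: field_simps)
    then have "l \<in> {\<lfloor>b / pi\<rfloor>..\<lceil>2 * q + b / pi\<rceil>}" by (auto simp: floor_le_iff le_ceiling_iff)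
    moreover have "(t, u) = g (k, l)" unfolding g_def prod.case k[symmetric] l[symmetric] by simp
    ultimately show "x \<in> g ` ({- p..p} \<times> {\<lfloor>b / pi\<rfloor>..\<lceil>2 * q + b / pi\<rceil>})" unfolding x using kp by blast
  qed
  then show ?thesis by (rule finite_subset) auto
qed

lemma eq_if_multiple_2pi:
  fixes k :: int
  assumes "t \<in> {0..<2*pi}" "u \<in> {0..<2*pi}" "t - u = 2 * pi * k"
  shows "t = u"
proof -
  have "\<bar>2 * pi * k\<bar> < 2 * pi * 1" using assms by auto
  then have "\<bar>real_of_int k\<bar> < 1" unfolding abs_mult by simp
  then have "k = 0" by linarith
  then show ?thesis using assms(3) by simp
qed

lemma finite_crossings:
  fixes p q :: int and a b :: real
  assumes pos: "p > 0" "q > 0" and cop: "coprime p q"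
    and nondeg: "(q * a - p * b) / pi \<notin> \<int>"
  shows "finite {(t :: real, u :: real). t \<in> {0..<2*pi} \<and> u \<in> {0..<2*pi} \<and> t \<noteq> u \<and>
    cos (p * t + a) = cos (p * u + a) \<and> cos (q * t + b) = cos (q * u + b)}" (is "finite ?S")
proof -
  define S1 where "S1 = {(t, u). t \<in> {0..<2*pi} \<and> u \<in> {0..<2*pi} \<and>
    (\<exists>(k::int) (l::int). t - u = 2 * pi * k / p \<and> t + u = (2 * pi * l - 2 * b) / q)}"
  define S2 where "S2 = {(t, u). t \<in> {0..<2*pi} \<and> u \<in> {0..<2*pi} \<and>
    (\<exists>(k::int) (l::int). t - u = 2 * pi * k / q \<and> t + u = (2 * pi * l - 2 * a) / p)}"
  have "?S \<subseteq> S1 \<union> S2"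
  proof safe
    fix t u :: real
    assume t: "t \<in> {0..<2*pi}" and u: "u \<in> {0..<2*pi}" and "(t, u) \<notin> S2"
      "cos (p * t + a) = cos (p * u + a)" "cos (q * t + b) = cos (q * u + b)" and ne: "t \<noteq> u"
    from pos cop this(4,5) show "(t, u) \<in> S1"
    proof (cases rule: cos_coincidence)
      case (same k)
      with eq_if_multiple_2pi[OF t u] ne show ?thesis by blast
    next
      case (first k l)
      then show ?thesis using t u unfolding S1_def by blast
    next
      case (second k l)
      then have "(t, u) \<in> S2" using t u unfolding S2_def by blast
      with \<open>(t, u) \<notin> S2\<close> show ?thesis by simp
    next
      case (degenerate i)
      with nondeg show ?thesis by simp
    qed
  qed
  moreover have "finite S1" "finite S2"
    unfolding S1_def S2_def using finite_crossings_aux pos by blast+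
  ultimately show ?thesis by (meson finite_UnI finite_subset)
qed

section \<open>Embeddedness in terms of integrality of A and B\<close>

lemma lissajous_curve_periodic:
  "lissajous_curve nx ny nz px py pz (t + 2 * pi * of_int k) = lissajous_curve nx ny nz px py pz t"
proof -
  have "n * (t + 2 * pi * of_int k) + p = (n * t + p) + 2 * pi * of_int (n * k)" for n :: int and p :: real
    by (simp add: algebra_simps)
  then have "cos (n * (t + 2 * pi * of_int k) + p) = cos (n * t + p)" for n :: int and p :: real
    by (simp only: cos_add_2pi_int)
  then show ?thesis by (simp add: lissajous_curve_def)
qed

lemma reduce_mod_2pi:
  obtains k :: int where "t + 2 * pi * of_int k \<in> {s..<s + 2*pi}"
proof -
  define k where "k = - \<lfloor>(t - s) / (2 * pi)\<rfloor>"
  have "real_of_int (- k) \<le> (t - s) / (2 * pi)" "(t - s) / (2 * pi) < real_of_int (- k) + 1"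
    unfolding k_def by linarith+
  then have "t + 2 * pi * of_int k \<in> {s..<s + 2*pi}" by (auto simp: field_simps)
  then show thesis by (rule that)
qed

text \<open>Coincidences at arbitrary real times become usable, with no reduction to one
  period.\<close>

lemma lissajous_inj_iff:
  "inj_on (lissajous_curve nx ny nz px py pz) {0..<2*pi} \<longleftrightarrow>
   (\<forall>t u. lissajous_curve nx ny nz px py pz t = lissajous_curve nx ny nz px py pz u \<longrightarrow>
     (\<exists>k :: int. t - u = 2 * pi * k))"
  (is "inj_on ?K _ \<longleftrightarrow> _")
proof (intro iffI allI impI)
  fix t u assume inj: "inj_on ?K {0..<2*pi}" and eq: "?K t = ?K u"
  obtain i :: int where i: "t + 2 * pi * of_int i \<in> {0..<0 + 2*pi}" by (rule reduce_mod_2pi)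
  obtain j :: int where j: "u + 2 * pi * of_int j \<in> {0..<0 + 2*pi}" by (rule reduce_mod_2pi)
  have "?K (t + 2 * pi * of_int i) = ?K (u + 2 * pi * of_int j)"
    using eq by (simp only: lissajous_curve_periodic)
  with inj i j have "t + 2 * pi * of_int i = u + 2 * pi * of_int j" by (simp add: inj_on_eq_iff)
  then have "t - u = 2 * pi * of_int (j - i)" by (simp add: algebra_simps)
  then show "\<exists>k :: int. t - u = 2 * pi * k" by blast
next
  assume *: "\<forall>t u. ?K t = ?K u \<longrightarrow> (\<exists>k :: int. t - u = 2 * pi * k)"
  show "inj_on ?K {0..<2*pi}"
  proof (rule inj_onI)
    fix t u assume "t \<in> {0..<2*pi}" "u \<in> {0..<2*pi}" "?K t = ?K u"
    with * show "t = u" using eq_if_multiple_2pi by blast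
  qed
qed

lemma coincidence_on_wall:
  fixes p q n i :: int and a b c :: real
  assumes pos: "p > 1" "q > 0" and cop: "coprime q n" and wall: "(q * c - n * b) / pi = i"
  obtains t u :: real where "cos (p * t + a) = cos (p * u + a)" "cos (q * t + b) = cos (q * u + b)"
    "cos (n * t + c) = cos (n * u + c)" "\<nexists>k :: int. t - u = 2 * pi * k"
proof -
  \<comment> \<open>Bezout's identity yields an \<open>l\<close> with \<open>i + n * l\<close>
    divisible by \<open>q\<close>; the crossing with this index has vanishing height
    difference.\<close>
  obtain x y where "x * q + y * n = 1"
    using cop bezout_int[of q n] by (metis coprime_iff_gcd_eq_1)
  from arg_cong[OF this, of "\<lambda>w. w * i"] have "i + n * (- (y * i)) = q * (x * i)"
    by (simp add: algebra_simps)
  then obtain l h :: int where l: "i + n * l = q * h" by blast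
  \<comment> \<open>These are the times of the crossing with \<open>k = 1\<close>, which is genuine
    because \<open>p > 1\<close>.\<close>
  define t u where "t = ((2 * pi * l - 2 * b) / q + 2 * pi * of_int 1 / p) / 2"
    and "u = ((2 * pi * l - 2 * b) / q - 2 * pi * of_int 1 / p) / 2"
  have tu: "t - u = 2 * pi * of_int 1 / p" "t + u = (2 * pi * l - 2 * b) / q"
  proof -
    have "(r + s) / 2 - (r - s) / 2 = s" "(r + s) / 2 + (r - s) / 2 = r" for r s :: real
      by (simp_all add: field_simps)
    then show "t - u = 2 * pi * of_int 1 / p" "t + u = (2 * pi * l - 2 * b) / q"
      unfolding t_def u_def by blast+
  qed
  have p0: "p > 0" using pos by simp
  have "(q * c - n * b) / pi + n * l = of_int (i + n * l)" using wall by simp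
  then have "pi * ((q * c - n * b) / pi + n * l) / q = pi * of_int h"
    unfolding l using pos by simp
  then have "cos (n * t + c) = cos (n * u + c)"
    using height_difference[OF p0 pos(2) tu, of n c] by simp
  moreover have "\<nexists>k :: int. t - u = 2 * pi * k"
  proof
    assume "\<exists>k :: int. t - u = 2 * pi * k"
    then obtain k :: int where "2 * pi * of_int 1 / p = 2 * pi * k" using tu by auto
    then have "real_of_int 1 = real_of_int (k * p)" using p0 by (simp add: field_simps)
    then have "1 = k * p" by (simp only: of_int_eq_iff)
    then show False using pos by (metis dvd_triv_right zdvd_not_zless zero_less_one)
  qed
  ultimately show thesis using that crossing_coincidence[OF p0 pos(2) tu] by blast
qed

text \<open>A vanishing height difference at a crossing forces A or B to be an integer. The guards
  reflect that for nx = 1 or ny = 1 the corresponding family of crossings is empty.\<close>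

lemma lissajous_inj_if_off_walls:
  fixes nx ny n :: int and px py pz :: real
  assumes pos: "nx > 0" "ny > 0" and cop: "coprime nx ny" "coprime nx n" "coprime ny n"
    and nondeg: "(ny * px - nx * py) / pi \<notin> \<int>"
    and x: "nx > 1 \<Longrightarrow> (ny * pz - n * py) / pi \<notin> \<int>"
    and y: "ny > 1 \<Longrightarrow> (nx * pz - n * px) / pi \<notin> \<int>"
  shows "inj_on (lissajous_curve nx ny n px py pz) {0..<2*pi}"
  unfolding lissajous_inj_iff
proof (intro allI impI)
  have off: False
    if "p > 0" "q > 0" "coprime p n" "\<not> p dvd k" "cos (n * t + pz) = cos (n * u + pz)"
      and tu: "t - u = 2 * pi * k / p" "t + u = (2 * pi * l - 2 * b) / q"
      and w: "p > 1 \<Longrightarrow> (q * pz - n * b) / pi \<notin> \<int>"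
    for p q k l :: int and t u b :: real
  proof -
    have "p \<noteq> 1" using that(4) by auto
    then have "p > 1" using that(1) by simp
    have "sin (pi * ((q * pz - n * b) / pi + n * l) / q) = 0"
      using height_difference[OF that(1,2) tu, of n pz] sin_ratio_nonzero[OF that(1,3,4)] that(5) by simp
    then obtain i :: int where "pi * ((q * pz - n * b) / pi + n * l) / q = of_int i * pi"
      by (auto simp: sin_zero_iff_int2)
    then have "pi * (((q * pz - n * b) / pi + n * l) / q) = pi * of_int i" by (simp only: mult.commute times_divide_eq_right)
    then have "((q * pz - n * b) / pi + n * l) / q = of_int i" by (simp only: mult_cancel_left pi_neq_zero simp_thms)
    then have "(q * pz - n * b) / pi + n * l = of_int i * q" using that(2) by (simp add: divide_eq_eq)
    then have "(q * pz - n * b) / pi = of_int (i * q - n * l)" by (simp add: algebra_simps)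
    then show False using w[OF \<open>p > 1\<close>] by (metis Ints_of_int)
  qed
  fix t u
  assume "lissajous_curve nx ny n px py pz t = lissajous_curve nx ny n px py pz u"
  then have eq: "cos (nx * t + px) = cos (nx * u + px)" "cos (ny * t + py) = cos (ny * u + py)"
    "cos (n * t + pz) = cos (n * u + pz)" by (simp_all add: lissajous_curve_def)
  from pos cop(1) eq(1,2) show "\<exists>k :: int. t - u = 2 * pi * k"
  proof (cases rule: cos_coincidence)
    case (same k)
    then show ?thesis by blast
  next
    case (first k l)
    then show ?thesis using off[OF pos cop(2) first(1) eq(3) first(2,3) x] by blast
  next
    case (second k l)
    then show ?thesis using off[OF pos(2,1) cop(3) second(1) eq(3) second(2,3) y] by blast
  next
    case (degenerate i)
    with nondeg show ?thesis by simp
  qed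
qed

text \<open>The intermediate value theorem over one period makes every point reached, whether or not
  \<tau> is monotone.\<close>

lemma lissajous_image_reparam:
  assumes cont: "continuous_on {0..2*pi} \<tau>" and per: "\<tau> (2*pi) = \<tau> 0 + 2*pi"
  shows "(\<lambda>t. lissajous_curve nx ny n px py pz (\<tau> t)) ` {0..2*pi} = lissajous_curve nx ny n px py pz ` {0..2*pi}"
    (is "(\<lambda>t. ?K (\<tau> t)) ` _ = _")
proof (intro equalityI image_subsetI)
  fix t assume "t \<in> {0..2*pi}"
  obtain k :: int where "\<tau> t + 2 * pi * of_int k \<in> {0..<0 + 2*pi}" by (rule reduce_mod_2pi)
  then show "?K (\<tau> t) \<in> ?K ` {0..2*pi}"
    by (intro image_eqI[of _ _ "\<tau> t + 2 * pi * of_int k"]) (auto simp only: lissajous_curve_periodic, auto)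
next
  fix s assume "s \<in> {0..2*pi}"
  obtain k :: int where k: "s + 2 * pi * of_int k \<in> {\<tau> 0..<\<tau> 0 + 2*pi}" by (rule reduce_mod_2pi)
  have "\<exists>t\<ge>0. t \<le> 2*pi \<and> \<tau> t = s + 2 * pi * of_int k"
    by (rule IVT') (use k per cont in auto)
  then obtain t where "t \<in> {0..2*pi}" "\<tau> t = s + 2 * pi * of_int k" by auto
  then show "?K s \<in> (\<lambda>t. ?K (\<tau> t)) ` {0..2*pi}"
    by (intro image_eqI[of _ _ t]) (simp_all only: lissajous_curve_periodic)
qed

text \<open>A plane map moving one \<delta> to the other matches the diagrams up to
  reparametrisation. Afterwards corresponding crossings have equal signs, and a vertical isotopy
  adjusts the heights.\<close>

lemma ambient_isotopic_lissajous:
  fixes nx ny n n' c m :: int and px py pz px' py' pz' :: real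
  assumes pos: "nx > 0" "ny > 0" and cop: "coprime nx ny" "coprime nx n" "coprime ny n"
    and n': "n' = n + 2 * nx * ny * c"
    and \<delta>: "m < (ny * px - nx * py) / pi" "(ny * px - nx * py) / pi < m + 1"
    and \<delta>': "m < (ny * px' - nx * py') / pi" "(ny * px' - nx * py') / pi < m + 1"
    and A: "nx > 1 \<Longrightarrow> \<exists>(i::int) (e::int). i < (ny * pz - n * py) / pi \<and> (ny * pz - n * py) / pi < i + 1 \<and>
      i < (ny * pz' - n' * py') / pi + 2 * ny * e \<and> (ny * pz' - n' * py') / pi + 2 * ny * e < i + 1"
    and B: "ny > 1 \<Longrightarrow> \<exists>(i::int) (e::int). i < (nx * pz - n * px) / pi \<and> (nx * pz - n * px) / pi < i + 1 \<and>
      i < (nx * pz' - n' * px') / pi + 2 * nx * e \<and> (nx * pz' - n' * px') / pi + 2 * nx * e < i + 1"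
  shows "ambient_isotopic (lissajous_curve nx ny n px py pz ` {0..2*pi})
    (lissajous_curve nx ny n' px' py' pz' ` {0..2*pi})"
proof -
  define d d' where "d = (ny * px - nx * py) / pi" and "d' = (ny * px' - nx * py') / pi"
  obtain f where f: "circle_homeo f" and fd: "f d = d'"
    using circle_homeo_moves[of m d d'] \<delta> \<delta>' by (auto simp: d_def d'_def)
  have ef: "equivariant f" and cf: "continuous_on UNIV f" using f by (auto simp: circle_homeo_def)
  \<comment> \<open>On the first curve u is constantly \<open>d\<close> while v runs with time;
    \<open>\<tau> t\<close> is the time at which the second curve has coordinates \<open>d'\<close>
    and \<open>f (v t)\<close>.\<close>
  define v where "v t = (2 * real_of_int nx * real_of_int ny * t + ny * px + nx * py) / pi" for t :: real
  define \<tau> where "\<tau> t = (pi * f (v t) - ny * px' - nx * py') / (2 * real_of_int nx * real_of_int ny)" for t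
  have \<tau>: "nx * \<tau> t + px' = pi * (d' + f (v t)) / (2 * real_of_int ny)" "ny * \<tau> t + py' = pi * (f (v t) - d') / (2 * real_of_int nx)" for t
    using pos by (simp_all add: \<tau>_def d'_def field_simps)
  have uv: "(ny * (nx * t + px) - nx * (ny * t + py)) / pi = d"
    "(ny * (nx * t + px) + nx * (ny * t + py)) / pi = v t" for t :: real
    by (simp_all add: d_def v_def field_simps)
  have pm: "plane_map nx ny f (cos (nx * t + px), cos (ny * t + py), z)
     = (cos (nx * \<tau> t + px'), cos (ny * \<tau> t + py'), z)" for t z :: real
    unfolding plane_map_cos[OF pos ef] fold_x_def fold_y_def uv fd \<tau> ..
  \<comment> \<open>The plane map is injective, so the reparametrised projection has no new double
    points.\<close>
  have coincide: "cos (nx * t + px) = cos (nx * u + px)" "cos (ny * t + py) = cos (ny * u + py)"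
    if "cos (nx * \<tau> t + px') = cos (nx * \<tau> u + px')" "cos (ny * \<tau> t + py') = cos (ny * \<tau> u + py')" for t u :: real
  proof -
    define g where "g = inv f"
    have b: "bij f" by (rule circle_homeo_bij[OF f])
    have "equivariant g" unfolding g_def by (rule equivariant_inv[OF ef b])
    moreover have "g (f x) = x" for x using b by (simp add: g_def bij_is_inj)
    ultimately have inv: "plane_map nx ny g (plane_map nx ny f p) = p" for p
      by (rule plane_map_inverse[OF pos ef])
    have "(cos (nx * t + px), cos (ny * t + py), 0 :: real) = (cos (nx * u + px), cos (ny * u + py), 0)"
      using inv[of "(cos (nx * t + px), cos (ny * t + py), 0)"] inv[of "(cos (nx * u + px), cos (ny * u + py), 0)"]
      unfolding pm that by simp
    then show "cos (nx * t + px) = cos (nx * u + px)" "cos (ny * t + py) = cos (ny * u + py)" by auto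
  qed
  \<comment> \<open>At crossings v takes values in \<open>d\<close> or \<open>- d\<close> plus even
    integers, where \<open>f\<close> is known; hence \<open>\<tau>\<close> preserves the indices
    \<open>k\<close> and \<open>l\<close>.\<close>
  have even: "f (d + 2 * of_int j) = d' + 2 * of_int j" "f (- d + 2 * of_int j) = - d' + 2 * of_int j" for j
    by (simp_all only: equivariant_shift[OF ef] equivariant_minus[OF ef] fd)
  have sgn: "0 < (cos (n * t + pz) - cos (n * u + pz)) * (cos (n' * \<tau> t + pz') - cos (n' * \<tau> u + pz'))"
    if tu: "p > 0" "q > 0" "coprime p n" "\<not> p dvd k"
      "t - u = 2 * pi * k / p" "t + u = (2 * pi * l - 2 * b) / q"
      and tu': "\<tau> t - \<tau> u = 2 * pi * k / p" "\<tau> t + \<tau> u = (2 * pi * l - 2 * b') / q"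
      and r: "n' = n + 2 * q * p * c"
      and cell: "p > 1 \<Longrightarrow> \<exists>(i::int) (e::int). i < (q * pz - n * b) / pi \<and> (q * pz - n * b) / pi < i + 1 \<and>
        i < (q * pz' - n' * b') / pi + 2 * q * e \<and> (q * pz' - n' * b') / pi + 2 * q * e < i + 1"
    for p q k l :: int and t u b b' :: real
  proof -
    have "p \<noteq> 1" using tu(4) by auto
    then have "p > 1" using tu(1) by simp
    then obtain i e :: int where ie: "i < (q * pz - n * b) / pi" "(q * pz - n * b) / pi < i + 1"
        "i < (q * pz' - n' * b') / pi + 2 * q * e" "(q * pz' - n' * b') / pi + 2 * q * e < i + 1"
      using cell by blast
    have r': "n' = n + 2 * q * (p * c)" using r by (simp add: mult.assoc)
    \<comment> \<open>The frequencies differ by a multiple of \<open>2 * p\<close>, so this factor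
      is common to both height differences and enters the product squared.\<close>
    have s: "sin (pi * n' * k / p) = sin (pi * n * k / p)"
    proof -
      have "pi * n' * k / p = pi * n * k / p + 2 * pi * of_int (q * c * k)"
        using tu(1) by (simp add: r field_simps)
      then show ?thesis by (simp only: sin_add_2pi_int)
    qed
    have "0 < (sin (pi * n * k / p))\<^sup>2" using sin_ratio_nonzero[OF tu(1,3,4)] by simp
    moreover have "0 < sin (pi * ((q * pz - n * b) / pi + n * l) / q) * sin (pi * ((q * pz' - n' * b') / pi + n' * l) / q)"
      by (rule crossing_sign[OF tu(2) ie r'])
    ultimately have "0 < 4 * ((sin (pi * ((q * pz - n * b) / pi + n * l) / q) * sin (pi * ((q * pz' - n' * b') / pi + n' * l) / q))
      * (sin (pi * n * k / p))\<^sup>2)" by (simp only: mult_pos_pos zero_less_numeral)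
    then show ?thesis
      unfolding height_difference[OF tu(1,2,5,6)] height_difference[OF tu(1,2) tu'] s
      by (simp add: power2_eq_square mult_ac)
  qed
  have iso1: "ambient_isotopic (lissajous_curve nx ny n px py pz ` {0..2*pi})
      ((\<lambda>t. (cos (nx * \<tau> t + px'), cos (ny * \<tau> t + py'), cos (n * t + pz))) ` {0..2*pi})"
    using ambient_isotopic_plane_map[OF pos f, of "lissajous_curve nx ny n px py pz ` {0..2*pi}"]
    by (simp add: image_image lissajous_curve_def pm)
  have per: "\<tau> (2*pi) = \<tau> 0 + 2*pi"
  proof -
    have "v (2*pi) = v 0 + 2 * of_int (2 * nx * ny)" by (simp add: v_def field_simps)
    then have "f (v (2*pi)) = f (v 0) + 2 * of_int (2 * nx * ny)" by (simp only: equivariant_shift[OF ef])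
    then show ?thesis using pos by (simp add: \<tau>_def field_simps)
  qed
  have cont: "continuous_on {0..2*pi} \<tau>"
    unfolding \<tau>_def v_def using pos
    by (intro continuous_intros continuous_on_compose2[OF cf]) auto
  have per_cos: "cos (k * \<tau> (2*pi) + p) = cos (k * \<tau> 0 + p)" "cos (k * (2*pi) + p) = cos (k * (0::real) + p)" for k :: int and p :: real
    using lissajous_curve_periodic[of k k k p p p "\<tau> 0" 1] lissajous_curve_periodic[of k k k p p p 0 1]
    by (simp_all add: per lissajous_curve_def)
  have "ambient_isotopic
      ((\<lambda>t. (cos (nx * \<tau> t + px'), cos (ny * \<tau> t + py'), cos (n * t + pz))) ` {0..2*pi})
      ((\<lambda>t. (cos (nx * \<tau> t + px'), cos (ny * \<tau> t + py'), cos (n' * \<tau> t + pz'))) ` {0..2*pi})"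
  proof (rule ambient_isotopic_vertical_finite)
    have nondeg: "(ny * px - nx * py) / pi \<notin> \<int>"
    proof
      assume "(ny * px - nx * py) / pi \<in> \<int>"
      then obtain i :: int where "(ny * px - nx * py) / pi = i" by (auto elim: Ints_cases)
      with \<delta> have "real_of_int m < of_int i" "real_of_int i < of_int (m + 1)" by simp_all
      then have "m < i" "i < m + 1" by (simp_all only: of_int_less_iff)
      then show False by simp
    qed
    show "finite {(t, u). t \<in> {0..<2*pi} \<and> u \<in> {0..<2*pi} \<and> t \<noteq> u \<and>
      cos (nx * \<tau> t + px') = cos (nx * \<tau> u + px') \<and> cos (ny * \<tau> t + py') = cos (ny * \<tau> u + py')}"
      by (rule finite_subset[OF _ finite_crossings[OF pos cop(1) nondeg]]) (use coincide in blast)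
    fix t u assume t: "t \<in> {0..<2*pi}" and u: "u \<in> {0..<2*pi}" and ne: "t \<noteq> u"
      and eq: "cos (nx * \<tau> t + px') = cos (nx * \<tau> u + px')" "cos (ny * \<tau> t + py') = cos (ny * \<tau> u + py')"
    from pos cop(1) coincide[OF eq]
    show "0 < (cos (n * t + pz) - cos (n * u + pz)) * (cos (n' * \<tau> t + pz') - cos (n' * \<tau> u + pz'))"
    proof (cases rule: cos_coincidence)
      case (same k)
      with eq_if_multiple_2pi[OF t u] ne show ?thesis by blast
    next
      case (first k l)
      have vv: "v t = ((nx * ny) * (t + u) + (nx * ny) * (t - u) + ny * px + nx * py) / pi"
        "v u = ((nx * ny) * (t + u) - (nx * ny) * (t - u) + ny * px + nx * py) / pi"
        by (simp_all add: v_def algebra_simps)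
      have "v t = d + 2 * of_int (nx * l + ny * k)" "v u = d + 2 * of_int (nx * l - ny * k)"
        unfolding vv first using pos by (simp_all add: d_def field_simps)
      then have fv: "f (v t) = d' + 2 * of_int (nx * l + ny * k)" "f (v u) = d' + 2 * of_int (nx * l - ny * k)"
        by (simp_all only: even)
      have "\<tau> t - \<tau> u = 2 * pi * k / nx" "\<tau> t + \<tau> u = (2 * pi * l - 2 * py') / ny"
        unfolding \<tau>_def fv using pos by (simp_all add: d'_def field_simps)
      moreover have "n' = n + 2 * ny * nx * c" using n' by (simp add: mult_ac)
      ultimately show ?thesis by (rule sgn[OF pos cop(2) first _ _ _ A])
    next
      case (second k l)
      have vv: "v t = ((nx * ny) * (t + u) + (nx * ny) * (t - u) + ny * px + nx * py) / pi"
        "v u = ((nx * ny) * (t + u) - (nx * ny) * (t - u) + ny * px + nx * py) / pi"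
        by (simp_all add: v_def algebra_simps)
      have "v t = - d + 2 * of_int (ny * l + nx * k)" "v u = - d + 2 * of_int (ny * l - nx * k)"
        unfolding vv second using pos by (simp_all add: d_def field_simps)
      then have fv: "f (v t) = - d' + 2 * of_int (ny * l + nx * k)" "f (v u) = - d' + 2 * of_int (ny * l - nx * k)"
        by (simp_all only: even)
      have "\<tau> t - \<tau> u = 2 * pi * k / ny" "\<tau> t + \<tau> u = (2 * pi * l - 2 * px') / nx"
        unfolding \<tau>_def fv using pos by (simp_all add: d'_def field_simps)
      then show ?thesis by (rule sgn[OF pos(2,1) cop(3) second _ _ n' B])
    next
      case (degenerate i)
      with nondeg show ?thesis by simp
    qed
  qed (intro continuous_intros cont | simp only: per_cos)+
  moreover have "(\<lambda>t. (cos (nx * \<tau> t + px'), cos (ny * \<tau> t + py'), cos (n' * \<tau> t + pz'))) ` {0..2*pi}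
      = lissajous_curve nx ny n' px' py' pz' ` {0..2*pi}"
    using lissajous_image_reparam[OF cont per, of nx ny n' px' py' pz'] by (simp add: lissajous_curve_def)
  ultimately show ?thesis using ambient_isotopic_trans[OF iso1] by simp
qed

subsection \<open>Changing the third frequency\<close>

lemma lissajous_off_wall:
  fixes nx ny n :: int and px py pz :: real
  assumes "inj_on (lissajous_curve nx ny n px py pz) {0..<2*pi}"
    and "nx > 0" "ny > 0" "coprime nx n" "coprime ny n"
  shows "nx > 1 \<Longrightarrow> (ny * pz - n * py) / pi \<notin> \<int>"
    and "ny > 1 \<Longrightarrow> (nx * pz - n * px) / pi \<notin> \<int>"
proof -
  have inj: "\<exists>k :: int. t - u = 2 * pi * k"
    if "cos (nx * t + px) = cos (nx * u + px)" "cos (ny * t + py) = cos (ny * u + py)"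
      "cos (n * t + pz) = cos (n * u + pz)" for t u :: real
    using assms(1) that unfolding lissajous_inj_iff by (simp add: lissajous_curve_def)
  show "(ny * pz - n * py) / pi \<notin> \<int>" if "nx > 1"
  proof
    assume "(ny * pz - n * py) / pi \<in> \<int>"
    then obtain i :: int where "(ny * pz - n * py) / pi = i" by (auto elim: Ints_cases)
    from coincidence_on_wall[OF that assms(3,5) this, of px] inj show False by metis
  qed
  show "(nx * pz - n * px) / pi \<notin> \<int>" if "ny > 1"
  proof
    assume "(nx * pz - n * px) / pi \<in> \<int>"
    then obtain i :: int where "(nx * pz - n * px) / pi = i" by (auto elim: Ints_cases)
    from coincidence_on_wall[OF that assms(2,4) this, of py] inj show False by metis
  qed
qed

lemma coprime_add_mult_int: "coprime a b \<Longrightarrow> coprime a (b + a * k)" for a b k :: int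
  using gcd_add_mult[of a k b] by (simp add: coprime_iff_gcd_eq_1 add.commute mult.commute)

lemma not_Ints_cell: "x \<notin> \<int> \<longleftrightarrow> of_int \<lfloor>x\<rfloor> < x" for x :: real
proof -
  have "x \<in> \<int> \<longleftrightarrow> of_int \<lfloor>x\<rfloor> = x" by (metis Ints_cases Ints_of_int floor_of_int)
  then show ?thesis using of_int_floor_le[of x] by linarith
qed

lemma not_Ints_between: "of_int i < x \<Longrightarrow> x < of_int i + 1 \<Longrightarrow> x \<notin> \<int>" for x :: real and i :: int
  by (auto elim!: Ints_cases)

text \<open>Reduces a change of frequency to arithmetic: A, B and \<theta> in the prescribed unit
  intervals only have to satisfy the linear relation up to a multiple of 2 nx ny.\<close>

lemma lissajous_class_transfer:
  fixes nx ny n n' c e :: int and px py pz A B \<theta> :: real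
  defines "m \<equiv> \<lfloor>(ny * px - nx * py) / pi\<rfloor>"
    and "i \<equiv> \<lfloor>(ny * pz - n * py) / pi\<rfloor>" and "j \<equiv> \<lfloor>(nx * pz - n * px) / pi\<rfloor>"
  assumes pos: "nx > 0" "ny > 0" and cop: "coprime nx ny" "coprime nx n" "coprime ny n"
    and n': "n' = n + 2 * nx * ny * c"
    and inj: "inj_on (lissajous_curve nx ny n px py pz) {0..<2*pi}"
    and nondeg: "(ny * px - nx * py) / pi \<notin> \<int>"
    and \<theta>: "0 < \<theta>" "\<theta> < 1"
    and A: "nx > 1 \<Longrightarrow> i < A \<and> A < i + 1" and B: "ny > 1 \<Longrightarrow> j < B \<and> B < j + 1"
    and AB: "nx * A - ny * B = n' * (m + \<theta>) + 2 * nx * ny * e"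
  shows "{C. knot_equiv (lissajous_curve nx ny n px py pz ` {0..2*pi}) C} \<in> lissajous_types nx ny n'"
proof -
  \<comment> \<open>With \<open>px\<close> kept, \<open>py'\<close> realises
    \<open>m + \<theta>\<close> and then \<open>pz'\<close> realises \<open>A\<close>. The linear
    relation forces the third quantity to be \<open>B + 2 * nx * e\<close>.\<close>
  define py' where "py' = (ny * px - pi * (m + \<theta>)) / nx"
  define pz' where "pz' = (pi * A + n' * py') / ny"
  have d': "(ny * px - nx * py') / pi = m + \<theta>" using pos by (simp add: py'_def)
  have A': "(ny * pz' - n' * py') / pi = A" using pos by (simp add: pz'_def)
  have B': "(nx * pz' - n' * px) / pi = B + 2 * nx * e"
  proof -
    have "ny * ((nx * pz' - n' * px) / pi) = nx * ((ny * pz' - n' * py') / pi) - n' * ((ny * px - nx * py') / pi)"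
      by (simp add: field_simps)
    also have "\<dots> = ny * (B + 2 * nx * e)" unfolding A' d' using AB by (simp add: algebra_simps)
    finally show ?thesis using pos by (simp only: mult_cancel_left of_int_eq_0_iff) auto
  qed
  have cop': "coprime nx n'" "coprime ny n'"
  proof -
    have "coprime nx (n + nx * (2 * ny * c))" "coprime ny (n + ny * (2 * nx * c))"
      using cop by (simp_all only: coprime_add_mult_int)
    then show "coprime nx n'" "coprime ny n'" by (simp_all add: n' mult_ac)
  qed
  have Bi: "B + 2 * nx * e \<notin> \<int>" if "ny > 1"
    by (rule not_Ints_between[of "j + 2 * nx * e"]) (use B[OF that] in auto)
  have Ai: "A \<notin> \<int>" if "nx > 1"
    by (rule not_Ints_between[of i]) (use A[OF that] in auto)
  have "inj_on (lissajous_curve nx ny n' px py' pz') {0..<2*pi}"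
    by (rule lissajous_inj_if_off_walls[OF pos cop(1) cop'])
       (use Ai Bi not_Ints_between[of m "m + \<theta>"] \<theta> in \<open>simp_all add: A' B' d'\<close>)
  then have "lissajous_curve nx ny n' px py' pz' ` {0..2*pi} \<in> lissajous_knots nx ny n'"
    unfolding lissajous_knots_def by blast
  moreover have "ambient_isotopic (lissajous_curve nx ny n px py pz ` {0..2*pi})
    (lissajous_curve nx ny n' px py' pz' ` {0..2*pi})"
  proof (rule ambient_isotopic_lissajous[OF pos cop n', of m])
    show "m < (ny * px - nx * py) / pi" "(ny * px - nx * py) / pi < m + 1"
      using nondeg unfolding not_Ints_cell m_def by (auto intro: floor_correct[THEN conjunct2])
    show "m < (ny * px - nx * py') / pi" "(ny * px - nx * py') / pi < m + 1"
      using \<theta> by (simp_all add: d')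
    show "\<exists>(i::int) (e::int). i < (ny * pz - n * py) / pi \<and> (ny * pz - n * py) / pi < i + 1 \<and>
      i < (ny * pz' - n' * py') / pi + 2 * ny * e \<and> (ny * pz' - n' * py') / pi + 2 * ny * e < i + 1"
      if "nx > 1"
      unfolding A'
      by (rule exI[of _ i], rule exI[of _ 0])
         (use lissajous_off_wall(1)[OF inj pos cop(2,3) that] A[OF that] in
           \<open>simp add: not_Ints_cell i_def floor_correct\<close>)
    show "\<exists>(i::int) (e::int). i < (nx * pz - n * px) / pi \<and> (nx * pz - n * px) / pi < i + 1 \<and>
      i < (nx * pz' - n' * px) / pi + 2 * nx * e \<and> (nx * pz' - n' * px) / pi + 2 * nx * e < i + 1"
      if "ny > 1"
      unfolding B'
      by (rule exI[of _ j], rule exI[of _ "- e"])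
         (use lissajous_off_wall(2)[OF inj pos cop(2,3) that] B[OF that] in
           \<open>simp add: not_Ints_cell j_def floor_correct\<close>)
  qed
  ultimately show ?thesis
    unfolding lissajous_types_def using knot_class_eq by blast
qed

lemma lissajous_cells:
  fixes nx ny n :: int and px py pz :: real
  shows "nx * ((ny * pz - n * py) / pi) - ny * ((nx * pz - n * px) / pi) = n * ((ny * px - nx * py) / pi)"
  by (simp add: field_simps)

text \<open>A and B are kept. Shrinking the fractional part of \<delta> by the factor n / n' gives
  n' (m + \<theta>) = n \<delta> + 2 nx ny m, the right value up to a multiple of 2 nx ny.\<close>

lemma lissajous_class_up:
  fixes nx ny n :: int and px py pz :: real
  assumes pos: "nx > 0" "ny > 0" "n > 0" and cop: "coprime nx ny" "coprime nx n" "coprime ny n"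
    and inj: "inj_on (lissajous_curve nx ny n px py pz) {0..<2*pi}"
    and nondeg: "(ny * px - nx * py) / pi \<notin> \<int>"
  shows "{C. knot_equiv (lissajous_curve nx ny n px py pz ` {0..2*pi}) C}
    \<in> lissajous_types nx ny (n + 2 * nx * ny)"
proof -
  define n' where "n' = n + 2 * nx * ny"
  define d where "d = (ny * px - nx * py) / pi"
  define m where "m = \<lfloor>d\<rfloor>"
  define \<theta> where "\<theta> = n * (d - m) / n'"
  have n'n: "n' > n" "n' > 0" using pos by (simp_all add: n'_def add_pos_pos)
  have dm: "0 < d - m" "d - m < 1"
    using nondeg unfolding d_def[symmetric] not_Ints_cell m_def by linarith+
  have \<theta>: "0 < \<theta>" "\<theta> < 1"
  proof -
    show "0 < \<theta>" using dm pos n'n by (simp add: \<theta>_def)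
    have "n * (d - m) < real_of_int n * 1" using dm pos by (intro mult_strict_left_mono) auto
    then have "n * (d - m) < n'" using n'n by linarith
    then show "\<theta> < 1" using n'n by (simp add: \<theta>_def)
  qed
  have "{C. knot_equiv (lissajous_curve nx ny n px py pz ` {0..2*pi}) C} \<in> lissajous_types nx ny n'"
  proof (rule lissajous_class_transfer[OF pos(1,2) cop _ inj nondeg \<theta>, where e = "- m" and c = 1
      and A = "(ny * pz - n * py) / pi" and B = "(nx * pz - n * px) / pi"])
    show "n' = n + 2 * nx * ny * 1" by (simp add: n'_def)
    have n\<theta>: "n' * \<theta> = n * (d - m)" using n'n by (simp add: \<theta>_def)
    show "nx * ((ny * pz - n * py) / pi) - ny * ((nx * pz - n * px) / pi)
      = n' * (\<lfloor>(ny * px - nx * py) / pi\<rfloor> + \<theta>) + 2 * nx * ny * (- m)"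
      unfolding lissajous_cells d_def[symmetric] m_def[symmetric] distrib_left n\<theta>
      by (simp add: n'_def algebra_simps)
  qed (use lissajous_off_wall[OF inj pos(1,2) cop(2,3)] in \<open>auto simp: not_Ints_cell\<close>)
  then show ?thesis by (simp add: n'_def)
qed

text \<open>After subtracting n' m and reducing modulo 2 nx ny, the values of nx A - ny B over the
  given unit intervals fill (r - ny, r + nx), and n' \<theta> fills (0, n'). As 0 \<le> r < 2 nx ny,
  the lower bound on n' makes these intervals overlap.\<close>

lemma lissajous_class_down:
  fixes nx ny n' :: int and px py pz :: real
  assumes pos: "nx > 0" "ny > 0" "n' > 0" and cop: "coprime nx ny" "coprime nx n" "coprime ny n"
    and n: "n = n' + 2 * nx * ny" and large: "n' \<ge> 2 * nx * ny - ny"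
    and inj: "inj_on (lissajous_curve nx ny n px py pz) {0..<2*pi}"
    and nondeg: "(ny * px - nx * py) / pi \<notin> \<int>"
  shows "{C. knot_equiv (lissajous_curve nx ny n px py pz ` {0..2*pi}) C} \<in> lissajous_types nx ny n'"
proof -
  define m i j where "m = \<lfloor>(ny * px - nx * py) / pi\<rfloor>"
    and "i = \<lfloor>(ny * pz - n * py) / pi\<rfloor>" and "j = \<lfloor>(nx * pz - n * px) / pi\<rfloor>"
  define q where "q = nx * i - ny * j - n' * m"
  define r where "r = q mod (2 * nx * ny)"
  define e where "e = q div (2 * nx * ny)"
  have D: "2 * nx * ny > 0" using pos by simp
  have r: "0 \<le> r" "r < 2 * nx * ny" "q = r + 2 * nx * ny * e"
    using D by (simp_all add: r_def e_def)
  \<comment> \<open>The midpoint of the overlap.\<close>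
  define w where "w = (max 0 (real_of_int (r - ny)) + min (real_of_int n') (real_of_int (r + nx))) / 2"
  have "max 0 (real_of_int (r - ny)) < min (real_of_int n') (real_of_int (r + nx))"
    using r pos large by (simp add: less_diff_eq)
  then have w: "0 < w" "r - ny < w" "w < n'" "w < r + nx"
    unfolding w_def by auto
  \<comment> \<open>Moving A up and B down by the same parameter sweeps the whole interval
    \<open>(r - ny, r + nx)\<close>; \<open>\<kappa>\<close> is the parameter of
    \<open>w\<close>.\<close>
  define \<kappa> where "\<kappa> = (w - r + ny) / (nx + ny)"
  have \<kappa>: "0 < \<kappa>" "\<kappa> < 1" "(nx + ny) * \<kappa> = w - r + ny"
    using w pos by (simp_all add: \<kappa>_def)
  show ?thesis
  proof (rule lissajous_class_transfer[OF pos(1,2) cop _ inj nondeg, where e = e and c = "- 1"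
      and A = "i + \<kappa>" and B = "j + (1 - \<kappa>)" and \<theta> = "w / n'"])
    show "n' = n + 2 * nx * ny * (- 1)" by (simp add: n)
    show "0 < w / n'" "w / n' < 1" using w pos by simp_all
    have "nx * (i + \<kappa>) - ny * (j + (1 - \<kappa>)) = real_of_int (nx * i - ny * j) + ((nx + ny) * \<kappa> - ny)"
      by (simp add: algebra_simps)
    also have "\<dots> = real_of_int (q + n' * m) + (w - r)" unfolding \<kappa>(3) by (simp add: q_def)
    also have "\<dots> = n' * m + w + 2 * nx * ny * e" by (simp add: r(3))
    also have "\<dots> = n' * (m + w / n') + 2 * nx * ny * e" using pos by (simp add: distrib_left)
    finally show "nx * (i + \<kappa>) - ny * (j + (1 - \<kappa>))
      = n' * (\<lfloor>(ny * px - nx * py) / pi\<rfloor> + w / n') + 2 * nx * ny * e"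
      by (simp only: m_def)
  qed (use \<kappa> in \<open>simp_all add: i_def[symmetric] j_def[symmetric]\<close>)
qed

subsection \<open>Degenerate projections\<close>

text \<open>
  If the projection to the first two coordinates is degenerate, it is symmetric about some time
  \<open>c / 2\<close>, and the points at times \<open>c / 2 \<plusminus> \<pi> / n\<close> coincide.
\<close>

lemma degenerate_imp_height_frequency_1:
  fixes nx ny n :: int and px py pz :: real
  assumes pos: "nx > 0" "ny > 0" "n > 0" and cop: "coprime nx ny"
    and inj: "inj_on (lissajous_curve nx ny n px py pz) {0..<2*pi}"
    and deg: "(ny * px - nx * py) / pi \<in> \<int>"
  shows "n = 1"
proof -
  obtain i :: int where "(ny * px - nx * py) / pi = i" using deg by (auto elim: Ints_cases)
  then have i: "nx * py = ny * px - pi * i" by (simp add: field_simps)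
  \<comment> \<open>Bezout's identity makes \<open>ny * l\<close> congruent to \<open>i\<close>
    modulo \<open>nx\<close>, so reflecting time about \<open>c / 2\<close> preserves both
    horizontal cosines.\<close>
  obtain x y where "x * nx + y * ny = 1"
    using cop bezout_int[of nx ny] by (metis coprime_iff_gcd_eq_1)
  from arg_cong[OF this, of "\<lambda>w. w * i"] have "ny * (y * i) - i = nx * (- (x * i))"
    by (simp add: algebra_simps)
  then obtain l h where l: "ny * l - i = nx * h" by blast
  define c where "c = (2 * pi * l - 2 * px) / nx"
  define t where "t = c / 2 + pi / n"
  define u where "u = c / 2 - pi / n"
  have c1: "nx * c = 2 * pi * l - 2 * px" using pos by (simp add: c_def)
  have c2: "ny * c = 2 * pi * h - 2 * py"
  proof -
    have "nx * (ny * c) = ny * (2 * pi * l - 2 * px)" unfolding c1[symmetric] by simp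
    also have "\<dots> = 2 * pi * of_int (ny * l - i) - 2 * (ny * px - pi * i)" by (simp add: algebra_simps)
    also have "\<dots> = nx * (2 * pi * h - 2 * py)" unfolding l i[symmetric] by (simp add: algebra_simps)
    finally show ?thesis using pos by simp
  qed
  have tu: "t + u = c" "t - u = 2 * pi / n" by (simp_all add: t_def u_def)
  have "nx * t + px = - (nx * u + px) + 2 * of_int l * pi"
    using c1 unfolding tu(1)[symmetric] by (simp add: algebra_simps)
  moreover have "ny * t + py = - (ny * u + py) + 2 * of_int h * pi"
    using c2 unfolding tu(1)[symmetric] by (simp add: algebra_simps)
  moreover have "n * t + pz = n * u + pz + 2 * of_int 1 * pi"
  proof -
    have "n * (t - u) = 2 * pi" unfolding tu(2) using pos by simp
    then show ?thesis by (simp add: algebra_simps)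
  qed
  ultimately have "lissajous_curve nx ny n px py pz t = lissajous_curve nx ny n px py pz u"
    unfolding lissajous_curve_def cos_eq prod.inject by (metis Ints_of_int)
  then obtain k :: int where "2 * pi / n = 2 * pi * k"
    using inj tu(2) unfolding lissajous_inj_iff by metis
  then have "real_of_int 1 = real_of_int (k * n)" using pos by (simp add: field_simps)
  then have "k * n = 1" by (simp only: of_int_eq_iff)
  then show ?thesis using pos by (metis mult.commute zmult_eq_1_iff not_less_iff_gr_or_eq less_minus_one_simps(1) less_trans)
qed

text \<open>The projection along the y-axis has finitely many crossings, whose signs survive a small
  change of the y-phase. A nonzero change s - py with nx |s - py| < pi makes \<delta>
  non-integral.\<close>

lemma lissajous_perturb_y:
  fixes nx ny n :: int and px py pz :: real
  assumes pos: "nx > 0" "n > 0" and cop: "coprime nx n"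
    and inj: "inj_on (lissajous_curve nx ny n px py pz) {0..<2*pi}"
    and nondeg: "(n * px - nx * pz) / pi \<notin> \<int>"
    and deg: "(ny * px - nx * py) / pi \<in> \<int>"
  obtains py' :: real where "(ny * px - nx * py') / pi \<notin> \<int>"
    "inj_on (lissajous_curve nx ny n px py' pz) {0..<2*pi}"
    "ambient_isotopic (lissajous_curve nx ny n px py pz ` {0..2*pi})
       (lissajous_curve nx ny n px py' pz ` {0..2*pi})"
proof -
  define N where "N = {(t :: real, u :: real). t \<in> {0..<2*pi} \<and> u \<in> {0..<2*pi} \<and> t \<noteq> u \<and>
    cos (nx * t + px) = cos (nx * u + px) \<and> cos (n * t + pz) = cos (n * u + pz)}"
  have fin: "finite N" unfolding N_def by (rule finite_crossings[OF pos cop nondeg])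
  define y where "y s t = cos (ny * t + s)" for s t :: real
  have "\<forall>\<^sub>F s in at py. \<forall>p\<in>N. 0 < (y py (fst p) - y py (snd p)) * (y s (fst p) - y s (snd p))"
  proof (rule eventually_ball_finite[OF fin], rule ballI)
    fix p assume "p \<in> N"
    then obtain t u where p: "p = (t, u)" and N: "(t, u) \<in> N" by (metis prod.collapse)
    have "y py t \<noteq> y py u"
    proof
      assume "y py t = y py u"
      then have "lissajous_curve nx ny n px py pz t = lissajous_curve nx ny n px py pz u"
        using N by (simp add: N_def lissajous_curve_def y_def)
      then show False using inj N by (simp add: N_def inj_on_eq_iff)
    qed
    then have lim: "0 < (y py t - y py u) * (y py t - y py u)"
      by (simp add: zero_less_mult_iff) linarith
    have "((\<lambda>s. (y py t - y py u) * (y s t - y s u)) \<longlongrightarrow> (y py t - y py u) * (y py t - y py u)) (at py)"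
      unfolding y_def by (intro tendsto_intros)
    from order_tendstoD(1)[OF this lim]
    show "\<forall>\<^sub>F s in at py. 0 < (y py (fst p) - y py (snd p)) * (y s (fst p) - y s (snd p))"
      by (simp add: p)
  qed
  moreover have "\<forall>\<^sub>F s in at py. s \<noteq> py \<and> dist s py < pi / nx"
    unfolding eventually_at using pos by (intro exI[of _ "pi / nx"]) auto
  ultimately have "\<forall>\<^sub>F s in at py. (\<forall>p\<in>N. 0 < (y py (fst p) - y py (snd p)) * (y s (fst p) - y s (snd p)))
      \<and> s \<noteq> py \<and> dist s py < pi / nx" by (rule eventually_conj)
  then obtain s where s: "\<forall>p\<in>N. 0 < (y py (fst p) - y py (snd p)) * (y s (fst p) - y s (snd p))"
    "s \<noteq> py" "dist s py < pi / nx"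
    using eventually_happens'[OF at_neq_bot] by blast
  have sgn: "0 < (y py t - y py u) * (y s t - y s u)" if "(t, u) \<in> N" for t u
    using s(1) that by fastforce
  show thesis
  proof (rule that[of s])
    show "(ny * px - nx * s) / pi \<notin> \<int>"
    proof
      assume "(ny * px - nx * s) / pi \<in> \<int>"
      then have "(ny * px - nx * py) / pi - (ny * px - nx * s) / pi \<in> \<int>" using deg by (rule Ints_diff[rotated])
      moreover have "(ny * px - nx * py) / pi - (ny * px - nx * s) / pi = nx * (s - py) / pi"
        by (simp add: field_simps)
      ultimately obtain k :: int where k: "nx * (s - py) / pi = k" by (auto elim: Ints_cases)
      have "nx * \<bar>s - py\<bar> < pi" using s(3) pos by (simp add: dist_real_def field_simps)
      then have "\<bar>nx * (s - py) / pi\<bar> < 1" using pos by (simp add: abs_mult)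
      then have "k = 0" unfolding k by linarith
      then show False using k s(2) pos by simp
    qed
    show "inj_on (lissajous_curve nx ny n px s pz) {0..<2*pi}"
    proof (rule inj_onI, rule ccontr)
      fix t u assume "t \<in> {0..<2*pi}" "u \<in> {0..<2*pi}" "t \<noteq> u"
        "lissajous_curve nx ny n px s pz t = lissajous_curve nx ny n px s pz u"
      then have "(t, u) \<in> N" "y s t = y s u" by (simp_all add: N_def lissajous_curve_def y_def)
      then show False using sgn[of t u] by simp
    qed
    \<comment> \<open>Exchanging y and z turns the vertical isotopy into one along the
      y-axis.\<close>
    define h :: "R3 \<Rightarrow> R3" where "h = (\<lambda>p. (fst p, snd (snd p), fst (snd p)))"
    have h: "homeomorphism UNIV UNIV h h"
      unfolding h_def by (rule homeomorphism_involution) (auto intro!: continuous_intros)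
    have per: "cos (k * (2*pi) + p) = cos (k * (0::real) + p)" for k :: int and p :: real
      using lissajous_curve_periodic[of k k k p p p 0 1] by (simp add: lissajous_curve_def)
    have "ambient_isotopic ((\<lambda>t. (cos (nx * t + px), cos (n * t + pz), y py t)) ` {0..2*pi})
        ((\<lambda>t. (cos (nx * t + px), cos (n * t + pz), y s t)) ` {0..2*pi})"
      unfolding y_def
    proof (rule ambient_isotopic_vertical_finite)
      show "0 < (cos (ny * t + py) - cos (ny * u + py)) * (cos (ny * t + s) - cos (ny * u + s))"
        if "t \<in> {0..<2*pi}" "u \<in> {0..<2*pi}" "t \<noteq> u" "cos (nx * t + px) = cos (nx * u + px)"
          "cos (n * t + pz) = cos (n * u + pz)" for t u :: real
        using sgn[of t u] that by (simp add: N_def y_def)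
    qed (use fin in \<open>auto intro!: continuous_intros simp only: N_def per\<close>)
    from ambient_isotopic_image[OF this h]
    show "ambient_isotopic (lissajous_curve nx ny n px py pz ` {0..2*pi})
       (lissajous_curve nx ny n px s pz ` {0..2*pi})"
      unfolding image_image h_def fst_conv snd_conv y_def lissajous_curve_def .
  qed
qed

lemma lissajous_swap_xy:
  defines "h \<equiv> \<lambda>p::R3. (fst (snd p), fst p, snd (snd p))"
  shows "h ` lissajous_curve nx ny n px py pz ` S = lissajous_curve ny nx n py px pz ` S"
    and "homeomorphism UNIV UNIV h h"
    and "inj_on (lissajous_curve nx ny n px py pz) {0..<2*pi} \<longleftrightarrow>
      inj_on (lissajous_curve ny nx n py px pz) {0..<2*pi}"
proof -
  show "h ` lissajous_curve nx ny n px py pz ` S = lissajous_curve ny nx n py px pz ` S"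
    by (simp add: image_image h_def lissajous_curve_def)
  show "homeomorphism UNIV UNIV h h"
    unfolding h_def by (rule homeomorphism_involution) (auto intro!: continuous_intros)
  show "inj_on (lissajous_curve nx ny n px py pz) {0..<2*pi} \<longleftrightarrow>
      inj_on (lissajous_curve ny nx n py px pz) {0..<2*pi}"
    by (auto simp: inj_on_def lissajous_curve_def)
qed

text \<open>For integral \<delta> the x- or the y-phase is perturbed. One of the two is possible: if
  the other two coordinate projections were degenerate as well, a common reflection of time would
  identify two points of the curve.\<close>

lemma lissajous_nondegenerate_representative:
  fixes nx ny n :: int and px py pz :: real
  assumes pos: "nx > 0" "ny > 0" "n > 0" and cop: "coprime nx ny" "coprime nx n" "coprime ny n"
    and inj: "inj_on (lissajous_curve nx ny n px py pz) {0..<2*pi}"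
  obtains px' py' :: real where "(ny * px' - nx * py') / pi \<notin> \<int>"
    "inj_on (lissajous_curve nx ny n px' py' pz) {0..<2*pi}"
    "ambient_isotopic (lissajous_curve nx ny n px py pz ` {0..2*pi})
       (lissajous_curve nx ny n px' py' pz ` {0..2*pi})"
proof (cases "(ny * px - nx * py) / pi \<in> \<int>")
  case False
  then show thesis using that inj ambient_isotopic_refl by blast
next
  case deg: True
  show thesis
  proof (cases "(n * px - nx * pz) / pi \<in> \<int>")
    case False
    from lissajous_perturb_y[OF pos(1,3) cop(2) inj False deg] that show thesis by blast
  next
    case True
    have n: "n = 1" by (rule degenerate_imp_height_frequency_1[OF pos cop(1) inj deg])
    have nondeg: "(n * py - ny * pz) / pi \<notin> \<int>"
    proof
      assume "(n * py - ny * pz) / pi \<in> \<int>"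
      then obtain j :: int where "(py - ny * pz) / pi = j" using n by (auto elim: Ints_cases)
      then have j: "py - ny * pz = pi * j" by (simp add: field_simps)
      obtain i :: int where "(px - nx * pz) / pi = i" using True n by (auto elim: Ints_cases)
      then have i: "px - nx * pz = pi * i" by (simp add: field_simps)
      \<comment> \<open>These times are exchanged by the reflection about \<open>- pz\<close>, which
        preserves all three cosines, yet they differ by only \<open>pi\<close>.\<close>
      define t u where "t = - pz + pi/2" and "u = - pz - pi/2"
      have "nx * t + px = - (nx * u + px) + 2 * of_int i * pi"
        "ny * t + py = - (ny * u + py) + 2 * of_int j * pi"
        "n * t + pz = - (n * u + pz) + 2 * of_int 0 * pi"
        using i j n by (simp_all add: t_def u_def algebra_simps)
      then have "lissajous_curve nx ny n px py pz t = lissajous_curve nx ny n px py pz u"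
        unfolding lissajous_curve_def cos_eq prod.inject by (metis Ints_of_int)
      then obtain k :: int where "t - u = 2 * pi * k"
        using inj unfolding lissajous_inj_iff by metis
      then have "real_of_int 1 = real_of_int (2 * k)" by (simp add: t_def u_def)
      then have "1 = 2 * k" by (simp only: of_int_eq_iff)
      then show False by presburger
    qed
    have minus: "(nx * py - ny * x) / pi = - ((ny * x - nx * py) / pi)" for x :: real
      by (simp add: minus_divide_left)
    have "(nx * py - ny * px) / pi \<in> \<int>"
      unfolding minus by (rule Ints_minus[OF deg])
    then obtain px' :: real where px': "(nx * py - ny * px') / pi \<notin> \<int>"
      "inj_on (lissajous_curve ny nx n py px' pz) {0..<2*pi}"
      "ambient_isotopic (lissajous_curve ny nx n py px pz ` {0..2*pi})
         (lissajous_curve ny nx n py px' pz ` {0..2*pi})"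
      using lissajous_perturb_y[OF pos(2,3) cop(3) lissajous_swap_xy(3)[THEN iffD1, OF inj] nondeg] by blast
    show thesis
    proof (rule that[of px' py])
      show "(ny * px' - nx * py) / pi \<notin> \<int>"
      proof
        assume "(ny * px' - nx * py) / pi \<in> \<int>"
        from Ints_minus[OF this] px'(1) show False unfolding minus by contradiction
      qed
      show "inj_on (lissajous_curve nx ny n px' py pz) {0..<2*pi}"
        using px'(2) lissajous_swap_xy(3) by blast
      from ambient_isotopic_image[OF px'(3) lissajous_swap_xy(2)]
      show "ambient_isotopic (lissajous_curve nx ny n px py pz ` {0..2*pi})
         (lissajous_curve nx ny n px' py pz ` {0..2*pi})"
        by (simp only: lissajous_swap_xy(1))
    qed
  qed
qed

theorem theorem2:
  fixes nx ny nz :: int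
  assumes "nx > 0" and "ny > 0" and "nz > 0"
    and "coprime nx ny" and "coprime nx nz" and "coprime ny nz"
  shows "lissajous_types nx ny nz \<subseteq> lissajous_types nx ny (nz + 2 * nx * ny) \<and>
         (nz \<ge> 2 * nx * ny - ny \<longrightarrow>
           lissajous_types nx ny nz = lissajous_types nx ny (nz + 2 * nx * ny))"
proof -
  define n where "n = nz + 2 * nx * ny"
  have n: "n > 0" "coprime nx n" "coprime ny n"
  proof -
    show "n > 0" using assms by (simp add: n_def add_pos_pos)
    have "coprime nx (nz + nx * (2 * ny))" "coprime ny (nz + ny * (2 * nx))"
      using assms by (simp_all only: coprime_add_mult_int)
    then show "coprime nx n" "coprime ny n" by (simp_all add: n_def mult_ac)
  qed
  \<comment> \<open>Every knot type has a representative with non-integral \<delta>, to which the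
    transfers between the two frequencies apply.\<close>
  have rep: "\<exists>(px::real) (py::real) pz. (ny * px - nx * py) / pi \<notin> \<int> \<and>
      inj_on (lissajous_curve nx ny k px py pz) {0..<2*pi} \<and>
      T = {C. knot_equiv (lissajous_curve nx ny k px py pz ` {0..2*pi}) C}"
    if T: "T \<in> lissajous_types nx ny k" and k: "k > 0" "coprime nx k" "coprime ny k" for T k
  proof -
    obtain px py pz where inj: "inj_on (lissajous_curve nx ny k px py pz) {0..<2*pi}"
      and T: "T = {C. knot_equiv (lissajous_curve nx ny k px py pz ` {0..2*pi}) C}"
      using T unfolding lissajous_types_def lissajous_knots_def by blast
    obtain px' py' :: real where "(ny * px' - nx * py') / pi \<notin> \<int>"
      "inj_on (lissajous_curve nx ny k px' py' pz) {0..<2*pi}"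
      "ambient_isotopic (lissajous_curve nx ny k px py pz ` {0..2*pi})
         (lissajous_curve nx ny k px' py' pz ` {0..2*pi})"
      by (rule lissajous_nondegenerate_representative[OF assms(1,2) k(1) assms(4) k(2,3) inj])
    then show ?thesis unfolding T using knot_class_eq by blast
  qed
  have up: "lissajous_types nx ny nz \<subseteq> lissajous_types nx ny n"
  proof
    fix T assume "T \<in> lissajous_types nx ny nz"
    from rep[OF this assms(3,5,6)] show "T \<in> lissajous_types nx ny n"
      using lissajous_class_up[OF assms] unfolding n_def by blast
  qed
  moreover have "lissajous_types nx ny n \<subseteq> lissajous_types nx ny nz" if "nz \<ge> 2 * nx * ny - ny"
  proof
    fix T assume "T \<in> lissajous_types nx ny n"
    from rep[OF this n] show "T \<in> lissajous_types nx ny nz"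
      using lissajous_class_down[OF assms(1-4) n(2,3) n_def that] by blast
  qed
  ultimately show ?thesis unfolding n_def by blast
qed

end
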